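(* Assume that $f+g$ is bounded from below and that $\gamma,\lambda>0$ are such that $A<0$, $B<0$ and $C<0$. For $u_0,v_0\in\mathbb{R}^n$, let $x\in C^2([0,+\infty),\mathbb{R}^n)$ be the unique global solution of $$\ddot{x}(t)+\gamma\dot{x}(t)+x(t)=\operatorname{prox}_{\lambda f}\big(x(t)-\lambda\nabla g(x(t))\big),\qquad x(0)=u_0,\ \dot{x}(0)=v_0.$$ Consider the function $$H:\mathbb{R}^n\times\mathbb{R}^n\times\mathbb{R}^n\to\mathbb{R}\cup\{+\infty\},\qquad H(u,v,w)=(f+g)(u)+\frac{1}{2\lambda}\|u-v\|^2-\frac{C}{2\lambda}\|w\|^2.$$ Suppose that $x$ is bounded and that $H$ is a KL function. Then the following statements are true: (a) $\dot{x}\in L^1([0,+\infty),\mathbb{R}^n)$; (b) $\ddot{x}\in L^1([0,+\infty),\mathbb{R}^n)$; (c) there exists $\overline{x}\in\operatorname{crit}(f+g)$ such that $\lim_{t\to+\infty}x(t)=\overline{x}$.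
   Context: Standing setting: $f:\mathbb{R}^n\to\mathbb{R}\cup\{+\infty\}$ is proper, convex and lower semicontinuous; $g:\mathbb{R}^n\to\mathbb{R}$ is a (possibly nonconvex) Fréchet differentiable function whose gradient is $\beta$-Lipschitz continuous, where $\beta\ge 0$, i.e. $\|\nabla g(x)-\nabla g(y)\|\le\beta\|x-y\|$ for all $x,y\in\mathbb{R}^n$. $\mathbb{R}^n$ carries the Euclidean norm. The proximal operator is $\operatorname{prox}_{\lambda f}(x)=\operatorname{argmin}_{y\in\mathbb{R}^n}\{f(y)+\frac{1}{2\lambda}\|y-x\|^2\}$. For all starting points $u_0,v_0$ and all $\gamma,\lambda>0$ the dynamical system has a unique global solution $x\in C^2([0,+\infty),\mathbb{R}^n)$. Constants: $L_1=\sqrt{\max\big((\gamma+1)^2,(\gamma+2)((1+\lambda\beta)^2+1)\big)}$, $L_2=\sqrt{\max\big((\gamma+1)^2+\gamma\lambda\beta,(2+\lambda\beta)^2+\gamma(2+\lambda\beta)\big)}$, $L=\min(L_1,L_2)$, $A=-\frac12\frac{\gamma}{\lambda}+\frac{\beta}{2}(L^2+2\gamma^2+1)$, $B=-\frac{1}{2L^2}\frac{\gamma}{\lambda}+\frac{\beta}{2}(L^2+\gamma^2+1)$, $C=-\frac{2L^2+1}{(L^2+1)^2}\gamma^2+3\beta\gamma\lambda-1$. Subdifferentials: for a proper lower semicontinuous $h:\mathbb{R}^m\to\mathbb{R}\cup\{+\infty\}$ and $x\in\operatorname{dom}h=\{x: h(x)<+\infty\}$, the Fréchet subdifferential is $\hat\partial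 h(x)=\{v:\liminf_{y\to x}\frac{h(y)-h(x)-\langle v,y-x\rangle}{\|y-x\|}\ge 0\}$ and the limiting subdifferential is $\partial h(x)=\{v:\exists x_k\to x,\ h(x_k)\to h(x),\ \exists v_k\in\hat\partial h(x_k),\ v_k\to v\}$; both are empty for $x\notin\operatorname{dom}h$. The set of critical points is $\operatorname{crit}(h)=\{x:0\in\partial h(x)\}$. KL property: for $\eta\in(0,+\infty]$ let $\Theta_\eta$ be the class of concave continuous functions $\varphi:[0,\eta)\to[0,+\infty)$ with $\varphi(0)=0$, $\varphi$ continuously differentiable on $(0,\eta)$, and $\varphi'(s)>0$ for all $s\in(0,\eta)$. A proper lower semicontinuous $h:\mathbb{R}^m\to\mathbb{R}\cup\{+\infty\}$ satisfies the Kurdyka–Łojasiewicz (KL) property at $\overline{x}\in\operatorname{dom}\partial h=\{x:\partial h(x)\ne\emptyset\}$ if there exist $\eta\in(0,+\infty]$, a neighborhood $U$ of $\overline{x}$ and $\varphi\in\Theta_\eta$ such that $\varphi'(h(x)-h(\overline{x}))\operatorname{dist}(0,\partial h(x))\ge 1$ for all $x\in U$ with $h(\overline{x})<h(x)<h(\overline{x})+\eta$, where $\operatorname{dist}(x,S)=\inf_{y\in S}\|x-y\|$. $h$ is a KL function if it satisfies the KL property at every point of $\operatorname{dom}\partial h$. *)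

theory Defs
  imports "HOL-Analysis.Analysis"
begin

definition proper_fun :: "('a \<Rightarrow> ereal) \<Rightarrow> bool" where
  "proper_fun h \<longleftrightarrow> (\<forall>x. h x \<noteq> -\<infinity>) \<and> (\<exists>x. h x < \<infinity>)"

text \<open>Only used for functions that never take the value \<open>-\<infinity>\<close>, so the sum on the right is
  never of the form \<open>\<infinity> - \<infinity>\<close>.\<close>

definition convex_fun :: "('a::real_vector \<Rightarrow> ereal) \<Rightarrow> bool" where
  "convex_fun h \<longleftrightarrow>
     (\<forall>x y. \<forall>t\<in>{0<..<1::real}.
        h ((1 - t) *\<^sub>R x + t *\<^sub>R y) \<le> ereal (1 - t) * h x + ereal t * h y)"

definition lsc_fun :: "('a::topological_space \<Rightarrow> ereal) \<Rightarrow> bool" where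
  "lsc_fun h \<longleftrightarrow> (\<forall>x. h x \<le> Liminf (at x) h)"

text \<open>For proper, convex, lower semicontinuous \<open>f\<close> and \<open>lam > 0\<close> the minimizer exists and is
  unique, so the choice made by \<^const>\<open>arg_min\<close> is immaterial.\<close>

definition prox :: "real \<Rightarrow> ('a::real_normed_vector \<Rightarrow> ereal) \<Rightarrow> 'a \<Rightarrow> 'a" where
  "prox lam f x = (ARG_MIN (\<lambda>y. f y + ereal (1 / (2 * lam) * (norm (y - x))\<^sup>2)) y. True)"

definition frechet_subdiff :: "('a::euclidean_space \<Rightarrow> ereal) \<Rightarrow> 'a \<Rightarrow> 'a set" where
  "frechet_subdiff h x =
     {v. h x < \<infinity> \<and>
         0 \<le> Liminf (at x)
               (\<lambda>y. (h y - h x - ereal (v \<bullet> (y - x))) / ereal (norm (y - x)))}"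

definition limiting_subdiff :: "('a::euclidean_space \<Rightarrow> ereal) \<Rightarrow> 'a \<Rightarrow> 'a set" where
  "limiting_subdiff h x =
     {v. h x < \<infinity> \<and>
         (\<exists>X V. X \<longlonglongrightarrow> x \<and> (\<lambda>k. h (X k)) \<longlonglongrightarrow> h x \<and>
                (\<forall>k::nat. V k \<in> frechet_subdiff h (X k)) \<and> V \<longlonglongrightarrow> v)}"

definition crit :: "('a::euclidean_space \<Rightarrow> ereal) \<Rightarrow> 'a set" where
  "crit h = {x. 0 \<in> limiting_subdiff h x}"

definition Theta :: "ereal \<Rightarrow> (real \<Rightarrow> real) set" where
  "Theta \<eta> =
     {\<phi>. concave_on {s. 0 \<le> s \<and> ereal s < \<eta>} \<phi> \<and>
         continuous_on {s. 0 \<le> s \<and> ereal s < \<eta>} \<phi> \<and>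
         (\<forall>s. 0 \<le> s \<and> ereal s < \<eta> \<longrightarrow> 0 \<le> \<phi> s) \<and>
         \<phi> 0 = 0 \<and>
         \<phi> C1_differentiable_on {s. 0 < s \<and> ereal s < \<eta>} \<and>
         (\<forall>s. 0 < s \<and> ereal s < \<eta> \<longrightarrow> 0 < deriv \<phi> s)}"

text \<open>The distance is extended-real valued because the distance to the empty set has to be
  \<open>\<infinity>\<close>; \<^const>\<open>infdist\<close> and \<^const>\<open>setdist\<close> yield \<open>0\<close> there.\<close>

definition edist_set :: "'a::metric_space \<Rightarrow> 'a set \<Rightarrow> ereal" where
  "edist_set x S = (INF y\<in>S. ereal (dist x y))"

text \<open>Where the inequality is required, \<open>h x - h xbar\<close> is finite and lies in \<open>(0, \<eta>)\<close>.\<close>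

definition KL_at :: "('a::euclidean_space \<Rightarrow> ereal) \<Rightarrow> 'a \<Rightarrow> bool" where
  "KL_at h xbar \<longleftrightarrow>
     (\<exists>\<eta> U \<phi>. 0 < \<eta> \<and> open U \<and> xbar \<in> U \<and> \<phi> \<in> Theta \<eta> \<and>
        (\<forall>x\<in>U. h xbar < h x \<and> h x < h xbar + \<eta> \<longrightarrow>
           1 \<le> ereal (deriv \<phi> (real_of_ereal (h x - h xbar)))
                 * edist_set 0 (limiting_subdiff h x)))"

definition KL_function :: "('a::euclidean_space \<Rightarrow> ereal) \<Rightarrow> bool" where
  "KL_function h \<longleftrightarrow>
     proper_fun h \<and> lsc_fun h \<and> (\<forall>x. limiting_subdiff h x \<noteq> {} \<longrightarrow> KL_at h x)"

definition const_L1 :: "real \<Rightarrow> real \<Rightarrow> real \<Rightarrow> real" where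
  "const_L1 \<gamma> lam \<beta> =
     sqrt (max ((\<gamma> + 1)\<^sup>2) ((\<gamma> + 2) * ((1 + lam * \<beta>)\<^sup>2 + 1)))"

definition const_L2 :: "real \<Rightarrow> real \<Rightarrow> real \<Rightarrow> real" where
  "const_L2 \<gamma> lam \<beta> =
     sqrt (max ((\<gamma> + 1)\<^sup>2 + \<gamma> * lam * \<beta>) ((2 + lam * \<beta>)\<^sup>2 + \<gamma> * (2 + lam * \<beta>)))"

definition const_L :: "real \<Rightarrow> real \<Rightarrow> real \<Rightarrow> real" where
  "const_L \<gamma> lam \<beta> = min (const_L1 \<gamma> lam \<beta>) (const_L2 \<gamma> lam \<beta>)"

definition const_A :: "real \<Rightarrow> real \<Rightarrow> real \<Rightarrow> real" where
  "const_A \<gamma> lam \<beta> =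
     - (1 / 2) * (\<gamma> / lam) + \<beta> / 2 * ((const_L \<gamma> lam \<beta>)\<^sup>2 + 2 * \<gamma>\<^sup>2 + 1)"

definition const_B :: "real \<Rightarrow> real \<Rightarrow> real \<Rightarrow> real" where
  "const_B \<gamma> lam \<beta> =
     - (1 / (2 * (const_L \<gamma> lam \<beta>)\<^sup>2)) * (\<gamma> / lam)
     + \<beta> / 2 * ((const_L \<gamma> lam \<beta>)\<^sup>2 + \<gamma>\<^sup>2 + 1)"

definition const_C :: "real \<Rightarrow> real \<Rightarrow> real \<Rightarrow> real" where
  "const_C \<gamma> lam \<beta> =
     - ((2 * (const_L \<gamma> lam \<beta>)\<^sup>2 + 1) / ((const_L \<gamma> lam \<beta>)\<^sup>2 + 1)\<^sup>2) * \<gamma>\<^sup>2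
     + 3 * \<beta> * \<gamma> * lam - 1"

text \<open>The norm of the product type is the Euclidean norm of the product space, as needed for the
  subdifferential of \<open>H\<close>.\<close>

definition H_fun ::
  "('a::euclidean_space \<Rightarrow> ereal) \<Rightarrow> ('a \<Rightarrow> real) \<Rightarrow> real \<Rightarrow> real \<Rightarrow> real
     \<Rightarrow> 'a \<times> 'a \<times> 'a \<Rightarrow> ereal" where
  "H_fun f g \<gamma> lam \<beta> =
     (\<lambda>(u, v, w).
        f u + ereal (g u) + ereal (1 / (2 * lam) * (norm (u - v))\<^sup>2)
        - ereal (const_C \<gamma> lam \<beta> / (2 * lam) * (norm w)\<^sup>2))"

end

theory Submission
  imports Defs
begin

text \<open>
  The trajectory has finite length because the function \<open>H\<close>, evaluated along it at a suitable point,
  is an energy that decreases fast compared with the size of its subgradients.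

  Let \<open>P y\<close> denote the proximal point of \<open>y - lam *\<^sub>R grad_g y\<close>, so that the equation reads
  \<open>x'' + \<gamma> *\<^sub>R x' + x = P x\<close>. The energy is \<open>E = H (P x, x + b *\<^sub>R x', x')\<close> with
  \<open>b = \<gamma> / (L\<^sup>2 + 1)\<close>. With this choice of \<open>b\<close> and the coefficient of the third component being \<open>- C / (2 * lam)\<close>, a
  formal differentiation gives \<open>E' \<le> A * \<parallel>x'\<parallel>\<^sup>2 + B * \<parallel>x''\<parallel>\<^sup>2\<close>; the algebra is
  in \<open>prox_grad_rate_bound\<close> and the Lipschitz constant \<open>L\<close> in \<open>const_L_lipschitz\<close>. Since \<open>P\<close>
  is only Lipschitz, \<open>x''\<close> need not be differentiable. Instead of derivatives almost everywhere
  the proof uses upper right difference quotients (\<open>E_dini\<close>), for which a bound at every point still integrates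
  (\<open>dini_imp_integral_bound\<close>).

  Put \<open>N = \<parallel>x'\<parallel> + \<parallel>x''\<parallel>\<close>. As \<open>E\<close> is bounded below, it converges, and \<open>N\<close> tends to \<open>0\<close>
  (\<open>N_tendsto_0\<close>). Hence a cluster point \<open>xbar\<close>, which exists since \<open>x\<close> is bounded, is a fixed point of
  \<open>P\<close>, which means that it is critical for \<open>f + g\<close>, and \<open>H\<close> at \<open>(xbar, xbar, 0)\<close> is the limit of
  \<open>E\<close> (\<open>cluster_point\<close>). Optimality of the proximal point gives a subgradient of \<open>H\<close> of norm at most
  \<open>M * N\<close> (\<open>subgradient_distance\<close>). Near \<open>xbar\<close> the KL inequality
  converts the quadratic decrease \<open>- \<delta> * N\<^sup>2\<close> of \<open>E\<close> into a linear decrease \<open>- (\<delta> / M) * N\<close> of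
  \<open>\<phi> (E - lim E)\<close> (\<open>KL_length_bound\<close>). So the length of \<open>(x, x')\<close> is controlled as long as \<open>x\<close> stays near
  \<open>xbar\<close>, and started late enough it is too short to escape (\<open>finite_length_trapping\<close>). Therefore \<open>N\<close> is
  integrable and \<open>x\<close> converges to \<open>xbar\<close>.
\<close>

section \<open>The proximal map of a convex lower semicontinuous function\<close>

lemma lsc_fun_open_superlevel:
  assumes "lsc_fun h"
  shows "open {y. c < h y}"
proof (subst open_subopen, intro ballI)
  fix y assume "y \<in> {y. c < h y}"
  then have y: "c < h y" by simp
  also have "h y \<le> Liminf (at y) h" using assms by (simp add: lsc_fun_def)
  finally have "eventually (\<lambda>z. c < h z) (at y)" by (rule less_LiminfD)
  then obtain S where "open S" "y \<in> S" "\<forall>z\<in>S. z \<noteq> y \<longrightarrow> c < h z"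
    by (auto simp: eventually_at_topological)
  with y show "\<exists>T. open T \<and> y \<in> T \<and> T \<subseteq> {y. c < h y}"
    by (intro exI[of _ S]) auto
qed

text \<open>If no point of \<open>K\<close> were minimal, the sets \<open>{y. h z < h y}\<close> with \<open>z \<in> K\<close> would cover \<open>K\<close>; the
  best of the finitely many \<open>z\<close> of a finite subcover is then itself uncovered.\<close>

lemma open_superlevel_attains_inf:
  fixes h :: "'a::topological_space \<Rightarrow> 'b::linorder"
  assumes h: "\<And>c. open {y. c < h y}" and K: "compact K" "K \<noteq> {}"
  obtains y where "y \<in> K" "\<And>z. z \<in> K \<Longrightarrow> h y \<le> h z"
proof -
  have "\<exists>y\<in>K. \<forall>z\<in>K. h y \<le> h z"
  proof (rule ccontr)
    assume "\<not> ?thesis"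
    then have lower: "\<forall>y\<in>K. \<exists>z\<in>K. h z < h y" by (meson not_le)
    then have "K \<subseteq> (\<Union>z\<in>K. {y. h z < h y})" by auto
    from compactE_image[OF K(1) _ this] h
    obtain D where D: "D \<subseteq> K" "finite D" "K \<subseteq> (\<Union>z\<in>D. {y. h z < h y})" by metis
    then have "D \<noteq> {}" using K by auto
    with D obtain d where d: "d \<in> D" "\<forall>z\<in>D. h d \<le> h z"
      by (meson arg_min_least arg_min_if_finite(1))
    with D obtain z where "z \<in> D" "h z < h d" by blast
    with d show False by force
  qed
  with that show ?thesis by blast
qed

lemma open_superlevel_add_continuous:
  fixes f :: "'a::topological_space \<Rightarrow> ereal"
  assumes f: "\<And>c. open {y. c < f y}" "\<And>y. f y \<noteq> -\<infinity>" and q: "continuous_on UNIV q"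
  shows "open {y. c < f y + ereal (q y)}"
proof (subst open_subopen, intro ballI)
  fix y assume "y \<in> {y. c < f y + ereal (q y)}"
  then have "c - ereal (q y) < f y"
    by (cases c; cases "f y") auto
  then obtain r where r: "c - ereal (q y) < ereal r" "ereal r < f y"
    using ereal_dense2 by blast
  let ?T = "{z. ereal r < f z} \<inter> {z. c < ereal (r + q z)}"
  have "open {z. c < ereal (r + q z)}"
  proof (cases c)
    case (real k)
    have "open {z. k < r + q z}" using q by (intro open_Collect_less continuous_intros)
    then show ?thesis by (simp add: real)
  qed auto
  then have "open ?T" using f(1) by (rule open_Int[rotated])
  moreover have "y \<in> ?T" using r by (cases c) auto
  moreover have "?T \<subseteq> {z. c < f z + ereal (q z)}"
  proof safe
    fix z assume "ereal r < f z" "c < ereal (r + q z)"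
    then show "c < f z + ereal (q z)"
      by (cases c; cases "f z") auto
  qed
  ultimately show "\<exists>T. open T \<and> y \<in> T \<and> T \<subseteq> {y. c < f y + ereal (q y)}" by blast
qed

text \<open>A minimum of \<open>f\<close> over a unit ball around \<open>y0\<close> bounds \<open>f\<close> from below on the unit sphere, and by
  convexity along rays this propagates outwards with at most linear decay. This replaces a separating
  hyperplane and is enough to make \<open>f\<close> plus a quadratic coercive.\<close>

lemma convex_lsc_linear_lower_bound:
  fixes f :: "'a::euclidean_space \<Rightarrow> ereal"
  assumes f: "proper_fun f" "convex_fun f" "lsc_fun f"
  obtains y0 c k where "f y0 = ereal c" "0 \<le> k"
    "\<And>y. 1 < norm (y - y0) \<Longrightarrow> ereal (c - k * norm (y - y0)) \<le> f y"
proof -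
  have ninf: "f y \<noteq> -\<infinity>" for y using f(1) by (simp add: proper_fun_def)
  obtain y0 where "f y0 < \<infinity>" using f(1) by (auto simp: proper_fun_def)
  with ninf obtain c where c: "f y0 = ereal c" by (metis ereal_cases less_irrefl)
  obtain y1 where y1: "y1 \<in> cball y0 1" "\<And>z. z \<in> cball y0 1 \<Longrightarrow> f y1 \<le> f z"
    using open_superlevel_attains_inf[of f "cball y0 1"] lsc_fun_open_superlevel[OF f(3)] by auto
  then have "f y1 \<le> ereal c" using c by (metis centre_in_cball zero_le_one)
  with ninf obtain m where m: "f y1 = ereal m"
    by (metis MInfty_neq_ereal(1) ereal_infty_less_eq(1) ereal_cases)
  have mc: "m \<le> c" using \<open>f y1 \<le> ereal c\<close> m by simp
  have "ereal (c - (c - m) * norm (y - y0)) \<le> f y" if y: "1 < norm (y - y0)" for y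
  proof (cases "f y")
    case (real d)
    define t where "t = 1 / norm (y - y0)"
    have n: "0 < norm (y - y0)" using y by linarith
    then have t: "0 < t" "t < 1" using y unfolding t_def by (simp_all only: zero_less_divide_1_iff divide_less_eq_1_pos)
    have "(1 - t) *\<^sub>R y0 + t *\<^sub>R y = y0 + t *\<^sub>R (y - y0)" by (simp add: algebra_simps)
    moreover have "y0 + t *\<^sub>R (y - y0) \<in> cball y0 1"
      using y by (simp add: dist_norm t_def)
    ultimately have "ereal m \<le> f ((1 - t) *\<^sub>R y0 + t *\<^sub>R y)"
      using y1(2) m by metis
    also have "\<dots> \<le> ereal (1 - t) * f y0 + ereal t * f y"
      using f(2)[unfolded convex_fun_def, rule_format, of t y0 y] t by simp
    finally have "m \<le> (1 - t) * c + t * d" using c real by simp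
    then have "m - c \<le> t * (d - c)" by (simp add: algebra_simps)
    then have "(m - c) * norm (y - y0) \<le> t * (d - c) * norm (y - y0)"
      by (rule mult_right_mono) simp
    also have "\<dots> = d - c" using n by (simp add: t_def)
    finally have "(m - c) * norm (y - y0) \<le> d - c" .
    then show ?thesis using real by (simp add: algebra_simps)
  qed (use ninf in auto)
  with that[OF c, of "c - m"] mc show ?thesis by auto
qed

text \<open>The quadratic term beats the linear lower bound of \<open>f\<close> outside a large ball, so that the minimum
  over the ball is global and \<^const>\<open>arg_min\<close> selects an actual minimizer.\<close>

lemma prox_minimizes:
  fixes f :: "'a::euclidean_space \<Rightarrow> ereal"
  assumes f: "proper_fun f" "convex_fun f" "lsc_fun f" and lam: "0 < lam"
  defines "F x y \<equiv> f y + ereal (1 / (2 * lam) * (norm (y - x))\<^sup>2)"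
  shows "F x (prox lam f x) \<le> F x y"
proof -
  have ninf: "f y \<noteq> -\<infinity>" for y using f(1) by (simp add: proper_fun_def)
  obtain y0 c k where c: "f y0 = ereal c" and k: "0 \<le> k"
    and low: "\<And>y. 1 < norm (y - y0) \<Longrightarrow> ereal (c - k * norm (y - y0)) \<le> f y"
    by (rule convex_lsc_linear_lower_bound[OF f]) (rule that)
  define q where "q y = 1 / (2 * lam) * (norm (y - x))\<^sup>2" for y
  define n where "n = norm (y0 - x)"
  \<comment> \<open>chosen so that \<open>R < r\<close> implies \<open>2 * n + 2 * lam * k \<le> r\<close>, where \<open>r\<close> is the distance from \<open>y0\<close>\<close>
  define R where "R = 2 + 2 * n + 2 * lam * k"
  have lk: "0 \<le> lam * k" using lam k by simp
  have R: "1 < R" using lam k by (simp add: R_def n_def add_pos_nonneg)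
  have open_F: "open {y. d < F x y}" for d
    unfolding F_def
    by (intro open_superlevel_add_continuous lsc_fun_open_superlevel f ninf continuous_intros)
  obtain p where p: "p \<in> cball y0 R" "\<And>z. z \<in> cball y0 R \<Longrightarrow> F x p \<le> F x z"
    using open_superlevel_attains_inf[of "F x" "cball y0 R"] open_F R by auto
  have far: "F x y0 \<le> F x z" if "z \<notin> cball y0 R" for z
  proof -
    define r where "r = norm (z - y0)"
    have r: "R < r" using that by (simp add: r_def dist_norm norm_minus_commute)
    have rn: "r - n \<le> norm (z - x)"
      unfolding r_def n_def using norm_triangle_ineq4[of "z - x" "y0 - x"] by simp
    have "n\<^sup>2 + 2 * lam * k * r \<le> (r - n)\<^sup>2"
    proof -
      have "0 \<le> r * (r - 2 * n - 2 * lam * k)"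
        using r R by (intro mult_nonneg_nonneg) (auto simp: R_def)
      then show ?thesis by (simp add: power2_eq_square algebra_simps)
    qed
    also have "\<dots> \<le> (norm (z - x))\<^sup>2"
      using rn r lk norm_ge_zero[of "y0 - x", folded n_def]
      by (intro power_mono) (auto simp: R_def)
    finally have "1 / (2 * lam) * (n\<^sup>2 + 2 * lam * k * r) \<le> q z"
      unfolding q_def using lam by (intro mult_left_mono) auto
    then have "q y0 + k * r \<le> q z"
      using lam by (simp add: q_def n_def distrib_left)
    moreover have "ereal (c - k * r) \<le> f z" using low[of z] r R by (simp add: r_def)
    ultimately show ?thesis
      unfolding F_def q_def[symmetric] c by (cases "f z") auto
  qed
  have "F x p \<le> F x z" for z
    using p(2)[of z] p(2)[of y0] far[of z] R by (cases "z \<in> cball y0 R") (auto intro: order_trans)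
  then have "is_arg_min (F x) (\<lambda>_. True) p"
    by (simp add: is_arg_min_linorder)
  then have "is_arg_min (F x) (\<lambda>_. True) (prox lam f x)"
    unfolding prox_def arg_min_def F_def by (rule someI)
  then show ?thesis by (simp add: is_arg_min_linorder)
qed

text \<open>Fermat's rule: compare the minimizer \<open>p\<close> with \<open>p + t *\<^sub>R (y - p)\<close>, use convexity of \<open>f\<close>, divide
  by \<open>t\<close> and let \<open>t\<close> tend to \<open>0\<close>.\<close>

lemma prox_subgradient:
  fixes f :: "'a::euclidean_space \<Rightarrow> ereal" and x y :: 'a
  assumes f: "proper_fun f" "convex_fun f" "lsc_fun f" and lam: "0 < lam"
  defines "p \<equiv> prox lam f x"
  shows "f p = ereal (real_of_ereal (f p))"
    and "ereal (real_of_ereal (f p) + ((x - p) /\<^sub>R lam) \<bullet> (y - p)) \<le> f y"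
proof -
  have ninf: "f y \<noteq> -\<infinity>" for y using f(1) by (simp add: proper_fun_def)
  note opt = prox_minimizes[OF f lam, of x, folded p_def]
  obtain y0 where "f y0 < \<infinity>" using f(1) by (auto simp: proper_fun_def)
  with opt[of y0] ninf[of p] obtain c where c: "f p = ereal c" by (cases "f p") auto
  then show "f p = ereal (real_of_ereal (f p))" by simp
  show "ereal (real_of_ereal (f p) + ((x - p) /\<^sub>R lam) \<bullet> (y - p)) \<le> f y"
  proof (cases "f y")
    case (real d)
    define e where "e = (norm (y - p))\<^sup>2"
    have ineq: "c + ((x - p) /\<^sub>R lam) \<bullet> (y - p) \<le> d + t * (e / (2 * lam))" if t: "0 < t" "t < 1" for t
    proof -
      have "f ((1 - t) *\<^sub>R p + t *\<^sub>R y) \<le> ereal (1 - t) * f p + ereal t * f y"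
        using f(2)[unfolded convex_fun_def, rule_format, of t p y] t by simp
      then have "f ((1 - t) *\<^sub>R p + t *\<^sub>R y) \<le> ereal ((1 - t) * c + t * d)"
        unfolding c real by simp
      moreover have "(1 - t) *\<^sub>R p + t *\<^sub>R y = p + t *\<^sub>R (y - p)" by (simp add: algebra_simps)
      ultimately have "f (p + t *\<^sub>R (y - p)) \<le> ereal ((1 - t) * c + t * d)" by simp
      from order_trans[OF opt[of "p + t *\<^sub>R (y - p)"] add_right_mono[OF this]]
      have "f p + ereal (1 / (2 * lam) * (norm (p - x))\<^sup>2)
          \<le> ereal ((1 - t) * c + t * d) + ereal (1 / (2 * lam) * (norm (p + t *\<^sub>R (y - p) - x))\<^sup>2)" .
      then have "c + (norm (p - x))\<^sup>2 / (2 * lam)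
          \<le> (1 - t) * c + t * d + (norm (p + t *\<^sub>R (y - p) - x))\<^sup>2 / (2 * lam)"
        by (simp add: c)
      moreover have "(norm (p + t *\<^sub>R (y - p) - x))\<^sup>2
          = (norm (p - x))\<^sup>2 - 2 * t * ((x - p) \<bullet> (y - p)) + t\<^sup>2 * e"
        unfolding e_def power2_norm_eq_inner
        by (simp add: power2_eq_square inner_add_left inner_add_right inner_diff_left inner_diff_right inner_commute algebra_simps)
      moreover have "((norm (p - x))\<^sup>2 - 2 * t * ((x - p) \<bullet> (y - p)) + t\<^sup>2 * e) / (2 * lam)
          = (norm (p - x))\<^sup>2 / (2 * lam) - t * (((x - p) \<bullet> (y - p)) / lam) + t * (t * (e / (2 * lam)))"
        by (simp add: add_divide_distrib diff_divide_distrib power2_eq_square)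
      ultimately have "t * (c + ((x - p) \<bullet> (y - p)) / lam) \<le> t * (d + t * (e / (2 * lam)))"
        by (simp add: distrib_left left_diff_distrib)
      then have "c + ((x - p) \<bullet> (y - p)) / lam \<le> d + t * (e / (2 * lam))"
        using t(1) by (rule mult_left_le_imp_le)
      moreover have "((x - p) /\<^sub>R lam) \<bullet> (y - p) = ((x - p) \<bullet> (y - p)) / lam"
        by (simp add: divide_inverse)
      ultimately show ?thesis by simp
    qed
    have "c + ((x - p) /\<^sub>R lam) \<bullet> (y - p) \<le> d + 0 * (e / (2 * lam))"
    proof (rule tendsto_lowerbound)
      show "((\<lambda>t. d + t * (e / (2 * lam))) \<longlongrightarrow> d + 0 * (e / (2 * lam))) (at_right 0)"
        by (intro tendsto_intros)
      show "eventually (\<lambda>t. c + ((x - p) /\<^sub>R lam) \<bullet> (y - p) \<le> d + t * (e / (2 * lam))) (at_right 0)"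
        using eventually_at_right_real[OF zero_less_one]
        by eventually_elim (intro ineq, simp_all)
    qed auto
    then show ?thesis by (simp add: c real)
  qed (use ninf in auto)
qed

text \<open>Monotonicity: add the two subgradient inequalities, each evaluated at the other proximal point.\<close>

lemma prox_nonexpansive:
  fixes f :: "'a::euclidean_space \<Rightarrow> ereal"
  assumes f: "proper_fun f" "convex_fun f" "lsc_fun f" and lam: "0 < lam"
  shows "norm (prox lam f x - prox lam f y) \<le> norm (x - y)"
proof -
  let ?p = "prox lam f x" and ?q = "prox lam f y"
  note S = prox_subgradient[OF f lam]
  have "real_of_ereal (f ?p) + ((x - ?p) /\<^sub>R lam) \<bullet> (?q - ?p) \<le> real_of_ereal (f ?q)"
    using S(2)[of x ?q] S(1)[of y] by (metis ereal_less_eq(3))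
  moreover have "real_of_ereal (f ?q) + ((y - ?q) /\<^sub>R lam) \<bullet> (?p - ?q) \<le> real_of_ereal (f ?p)"
    using S(2)[of y ?p] S(1)[of x] by (metis ereal_less_eq(3))
  moreover have "((x - ?p) /\<^sub>R lam) \<bullet> (?q - ?p) + ((y - ?q) /\<^sub>R lam) \<bullet> (?p - ?q)
      = - ((x - y - (?p - ?q)) \<bullet> (?p - ?q)) / lam"
    by (simp add: inner_diff_left inner_diff_right divide_inverse algebra_simps)
  ultimately have "- ((x - y - (?p - ?q)) \<bullet> (?p - ?q)) / lam \<le> 0" by linarith
  then have "0 \<le> (x - y - (?p - ?q)) \<bullet> (?p - ?q)"
    using lam by (simp add: divide_le_0_iff zero_le_divide_iff)
  then have "(norm (?p - ?q))\<^sup>2 \<le> (x - y) \<bullet> (?p - ?q)"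
    unfolding power2_norm_eq_inner inner_diff_left[of "x - y"] by linarith
  also have "\<dots> \<le> norm (x - y) * norm (?p - ?q)" by (rule norm_cauchy_schwarz)
  finally have le: "norm (?p - ?q) * norm (?p - ?q) \<le> norm (x - y) * norm (?p - ?q)"
    unfolding power2_eq_square .
  show ?thesis
  proof (cases "?p = ?q")
    case False
    then have "0 < norm (?p - ?q)" by simp
    with le show ?thesis by (rule mult_right_le_imp_le)
  qed simp
qed


section \<open>Calculus lemmas\<close>

text \<open>The constant \<open>\<beta>\<close> instead of the sharp \<open>\<beta> / 2\<close> is what a single application of the mean value
  theorem gives; only the quadratic order of the error matters below.\<close>

lemma GDERIV_quadratic_bound:
  fixes g :: "'a::real_inner \<Rightarrow> real"
  assumes g: "\<And>y. GDERIV g y :> G y"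
    and lip: "\<And>y z. norm (G y - G z) \<le> \<beta> * norm (y - z)" and \<beta>: "0 \<le> \<beta>"
  shows "g z - g y \<le> G y \<bullet> (z - y) + \<beta> * (norm (z - y))\<^sup>2"
proof -
  define k where "k s = g (y + s *\<^sub>R (z - y))" for s :: real
  have "(k has_real_derivative (z - y) \<bullet> G (y + s *\<^sub>R (z - y))) (at s)" for s
  proof -
    have "((\<lambda>s. y + s *\<^sub>R (z - y)) has_derivative (\<lambda>s. s *\<^sub>R (z - y))) (at s)"
      by (auto intro!: derivative_eq_intros)
    moreover have "(g has_derivative (\<lambda>d. d \<bullet> G (y + s *\<^sub>R (z - y)))) (at (y + s *\<^sub>R (z - y)))"
      using g by (simp add: gderiv_def)
    ultimately have "(k has_derivative (\<lambda>s'. (s' *\<^sub>R (z - y)) \<bullet> G (y + s *\<^sub>R (z - y)))) (at s)"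
      unfolding k_def by (rule has_derivative_compose)
    then show ?thesis by (simp add: has_field_derivative_def mult_commute_abs)
  qed
  then obtain s where s: "0 < s" "s < 1" "k 1 - k 0 = (z - y) \<bullet> G (y + s *\<^sub>R (z - y))"
    using MVT2[of 0 1 k "\<lambda>s. (z - y) \<bullet> G (y + s *\<^sub>R (z - y))"] by auto
  have "(z - y) \<bullet> (G (y + s *\<^sub>R (z - y)) - G y)
      \<le> norm (z - y) * norm (G (y + s *\<^sub>R (z - y)) - G y)" by (rule norm_cauchy_schwarz)
  also have "\<dots> \<le> norm (z - y) * (\<beta> * norm (z - y))"
  proof (intro mult_left_mono norm_ge_zero)
    have "norm (G (y + s *\<^sub>R (z - y)) - G y) \<le> \<beta> * norm (s *\<^sub>R (z - y))"
      using lip[of "y + s *\<^sub>R (z - y)" y] by simp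
    also have "\<dots> \<le> \<beta> * norm (z - y)"
      using s \<beta> by (intro mult_left_mono) (auto intro: mult_left_le_one_le)
    finally show "norm (G (y + s *\<^sub>R (z - y)) - G y) \<le> \<beta> * norm (z - y)" .
  qed
  finally have "(z - y) \<bullet> G (y + s *\<^sub>R (z - y)) \<le> G y \<bullet> (z - y) + \<beta> * (norm (z - y))\<^sup>2"
    by (simp add: inner_diff_right inner_commute power2_eq_square algebra_simps)
  with s(3) show ?thesis by (simp add: k_def)
qed

text \<open>A differentiable function that touches \<open>h\<close> from below transfers its gradient to the
  subdifferential of \<open>h\<close>. Every subgradient below is obtained in this way: the convex function \<open>f\<close>
  is replaced by one of its affine minorants, and all other terms are smooth already.\<close>

lemma frechet_subdiff_smooth_minorant:
  fixes h :: "'a::euclidean_space \<Rightarrow> ereal"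
  assumes below: "\<And>y. ereal (k y) \<le> h y" and touch: "h z = ereal (k z)"
    and k: "(k has_derivative (\<lambda>d. v \<bullet> d)) (at z)"
  shows "v \<in> frechet_subdiff h z"
proof -
  let ?Q = "\<lambda>y. (h y - h z - ereal (v \<bullet> (y - z))) / ereal (norm (y - z))"
  let ?q = "\<lambda>y. (k y - k z - v \<bullet> (y - z)) / norm (y - z)"
  have "0 \<le> Liminf (at z) ?Q"
    unfolding le_Liminf_iff
  proof safe
    fix c :: ereal assume "c < 0"
    then obtain e where e: "c < ereal e" "ereal e < 0" using ereal_dense2 by blast
    have "((\<lambda>y. norm (k y - k z - v \<bullet> (y - z)) / norm (y - z)) \<longlongrightarrow> 0) (at z)"
      using k unfolding has_derivative_iff_norm by simp
    then have "(?q \<longlongrightarrow> 0) (at z)"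
      by (intro tendsto_norm_zero_cancel[of ?q]) simp
    then have "eventually (\<lambda>y. e < ?q y) (at z)"
      using e by (intro order_tendstoD) auto
    then show "eventually (\<lambda>y. c < ?Q y) (at z)"
      using eventually_at_ball'[of 1 z UNIV, simplified]
    proof eventually_elim
      case (elim y)
      then have n: "0 < norm (y - z)" by simp
      have "ereal (?q y) = ereal (k y - k z - v \<bullet> (y - z)) / ereal (norm (y - z))"
        using n by simp
      also have "\<dots> \<le> ?Q y"
      proof (rule ereal_divide_right_mono)
        show "ereal (k y - k z - v \<bullet> (y - z)) \<le> h y - h z - ereal (v \<bullet> (y - z))"
          using below[of y] unfolding touch by (cases "h y") auto
      qed (use n in auto)
      finally have "ereal (?q y) \<le> ?Q y" .
      moreover have "c < ereal (?q y)" using less_trans[OF e(1), of "ereal (?q y)"] elim(1) by simp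
      ultimately show ?case by (rule less_le_trans[rotated])
    qed
  qed
  then show ?thesis by (simp add: frechet_subdiff_def touch)
qed

lemma frechet_subdiff_subset_limiting: "frechet_subdiff h z \<subseteq> limiting_subdiff h z"
proof
  fix v assume v: "v \<in> frechet_subdiff h z"
  then have "h z < \<infinity>" by (simp add: frechet_subdiff_def)
  moreover have "\<exists>X V. X \<longlonglongrightarrow> z \<and> (\<lambda>k. h (X k)) \<longlonglongrightarrow> h z
      \<and> (\<forall>k::nat. V k \<in> frechet_subdiff h (X k)) \<and> V \<longlonglongrightarrow> v"
  proof (intro exI conjI allI)
    show "(\<lambda>_. z) \<longlonglongrightarrow> z" "(\<lambda>k. h z) \<longlonglongrightarrow> h z" "(\<lambda>_. v) \<longlonglongrightarrow> v"
      by (rule tendsto_const)+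
  qed (rule v)
  ultimately show "v \<in> limiting_subdiff h z" by (simp add: limiting_subdiff_def)
qed

text \<open>A one-sided bound on difference quotients integrates even where \<open>W\<close> has no derivative. After
  subtracting \<open>integral {a..u} s + e * u\<close>, consider the last point at which the resulting function does
  not exceed its value at \<open>a\<close>: the hypothesis would allow to move further right unless this point is
  \<open>b\<close>.

  The energy of a trajectory is such a \<open>W\<close>: it contains \<open>x''\<close>, which is only locally Lipschitz.\<close>

lemma dini_imp_integral_bound:
  fixes W s :: "real \<Rightarrow> real"
  assumes ab: "a \<le> b" and W: "continuous_on {a..b} W" and s: "continuous_on {a..b} s"
    and dini: "\<And>t e. a \<le> t \<Longrightarrow> t < b \<Longrightarrow> 0 < e \<Longrightarrow>
      eventually (\<lambda>u. W u - W t \<le> (s t + e) * (u - t)) (at_right t)"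
  shows "W b - W a \<le> integral {a..b} s"
proof -
  define I where "I u = integral {a..u} s" for u
  have I: "continuous_on {a..b} I"
    unfolding I_def using s by (intro indefinite_integral_continuous_1 integrable_continuous_interval)
  have approx: "W b - I b \<le> W a + e * (b - a)" if e: "0 < e" for e
  proof -
    define Z where "Z = {u \<in> {a..b}. W u - I u - e * u \<le> W a - e * a}"
    have "closed ({a..b} \<inter> (\<lambda>u. W u - I u - e * u) -` {..W a - e * a})"
      by (intro continuous_closed_preimage continuous_intros W I)
    also have "{a..b} \<inter> (\<lambda>u. W u - I u - e * u) -` {..W a - e * a} = Z" by (auto simp: Z_def)
    finally have "closed Z" .
    moreover have "bounded Z" by (rule bounded_subset[of "{a..b}"]) (auto simp: Z_def)
    ultimately have "compact Z" by (simp add: compact_eq_bounded_closed)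
    moreover have "a \<in> Z" using ab by (simp add: Z_def I_def)
    ultimately obtain t where t: "t \<in> Z" "\<And>u. u \<in> Z \<Longrightarrow> u \<le> t"
      using compact_attains_sup[of Z] by auto
    have "t = b"
    proof (rule ccontr)
      assume "t \<noteq> b"
      with t have tb: "a \<le> t" "t < b" by (auto simp: Z_def)
      have "(I has_real_derivative s t) (at t within {a..b})"
        unfolding I_def using tb by (intro integral_has_real_derivative s) auto
      then have "(I has_real_derivative s t) (at t within {t..b})"
        using tb by (auto intro: DERIV_subset)
      then have "(I has_real_derivative s t) (at_right t)"
        using tb by (simp add: at_within_Icc_at_right)
      then have "((\<lambda>u. (I u - I t) / (u - t)) \<longlongrightarrow> s t) (at_right t)"
        by (simp add: has_field_derivative_iff)
      then have "eventually (\<lambda>u. s t - e / 2 < (I u - I t) / (u - t)) (at_right t)"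
        using e by (intro order_tendstoD) auto
      moreover have "eventually (\<lambda>u. W u - W t \<le> (s t + e / 2) * (u - t)) (at_right t)"
        using dini tb e by simp
      moreover have "eventually (\<lambda>u. u \<in> {t<..<b}) (at_right t)"
        by (rule eventually_at_right_real[OF tb(2)])
      ultimately have "eventually (\<lambda>u. u \<in> Z \<and> t < u) (at_right t)"
      proof eventually_elim
        case (elim u)
        then have u: "t < u" "u < b" by simp_all
        have "(s t - e / 2) * (u - t) \<le> I u - I t"
          using elim(1) u(1) by (simp add: pos_less_divide_eq less_imp_le)
        moreover have "(s t + e / 2) * (u - t) = (s t - e / 2) * (u - t) + e * (u - t)"
          by (simp add: left_diff_distrib distrib_right)
        ultimately have "W u - I u - e * u \<le> W t - I t - e * t"
          using elim(2) by (simp add: right_diff_distrib)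
        moreover have "W t - I t - e * t \<le> W a - e * a" using t(1) by (simp add: Z_def)
        ultimately show ?case using u tb by (simp add: Z_def)
      qed
      then have "\<exists>u. u \<in> Z \<and> t < u" by (rule eventually_happens'[rotated]) simp
      with t(2) show False by (meson not_le)
    qed
    with t(1) show ?thesis by (simp add: Z_def algebra_simps)
  qed
  have "W b - I b \<le> W a"
  proof (cases "a = b")
    case False
    show ?thesis
    proof (rule field_le_epsilon)
      fix e :: real assume "0 < e"
      with approx[of "e / (b - a)"] ab False show "W b - I b \<le> W a + e" by simp
    qed
  qed (simp add: I_def)
  then show ?thesis by (simp add: I_def)
qed

section \<open>The constants of the dynamical system\<close>

text \<open>This inequality is where the constants \<open>A\<close>, \<open>B\<close> and \<open>C\<close> come from. The vectors \<open>v\<close>, \<open>w\<close>, \<open>J\<close> stand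
  for \<open>x'\<close>, \<open>x''\<close> and the (finite-difference) third derivative, and \<open>G\<close> for the difference of the gradients of
  \<open>g\<close> at the proximal point and at \<open>x\<close>; the left-hand side is the formal derivative of the energy.

  Write \<open>a = \<gamma> - b = \<gamma> * Lsq / (Lsq + 1)\<close>. Since \<open>(2 * Lsq + 1) / (Lsq + 1)\<^sup>2 = 1 - (Lsq / (Lsq + 1))\<^sup>2\<close>,
  one has \<open>- C = 1 + \<gamma>\<^sup>2 - a\<^sup>2 - 3 * \<beta> * \<gamma> * lam\<close>. The first part of this makes all
  products \<open>w \<bullet> v\<close> cancel that do not contain \<open>\<beta>\<close>; the last summand cancels
  the term \<open>3 * \<beta> * \<gamma> * (w \<bullet> v)\<close> produced by estimating \<open>G\<close>. Apart from
  squares multiplied by \<open>\<beta>\<close>, what remains is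
  \<open>- (\<gamma> * v\<^sup>2 + b * w\<^sup>2 + b * (J \<bullet> v)) / lam\<close>, and Young's inequality with weight \<open>Lsq\<close> on
  \<open>J \<bullet> v\<close> leaves the coefficients \<open>A\<close> and \<open>B\<close>. The last line of the bound is nonpositive as soon as
  \<open>J\<^sup>2 + w\<^sup>2 \<le> Lsq * (v\<^sup>2 + w\<^sup>2)\<close>; being linear in \<open>J\<^sup>2\<close>, it can be used with difference
  quotients instead of derivatives.\<close>

lemma prox_grad_rate_bound:
  fixes G J v w :: "'a::real_inner" and Lsq \<gamma> lam \<beta> :: real
  assumes pos: "0 < \<gamma>" "0 < lam" "0 \<le> \<beta>" "0 < Lsq"
    and G: "norm G \<le> \<beta> * norm (w + \<gamma> *\<^sub>R v)"
  defines "b \<equiv> \<gamma> / (Lsq + 1)"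
  defines "a \<equiv> \<gamma> - b"
  defines "C \<equiv> - ((2 * Lsq + 1) / (Lsq + 1)\<^sup>2) * \<gamma>\<^sup>2 + 3 * \<beta> * \<gamma> * lam - 1"
  shows "(G - (w + \<gamma> *\<^sub>R v) /\<^sub>R lam) \<bullet> (J + \<gamma> *\<^sub>R w + v)
      + (1 / lam) * ((J + a *\<^sub>R w) \<bullet> (w + a *\<^sub>R v)) - C / lam * (w \<bullet> v)
    \<le> (- (1 / 2) * (\<gamma> / lam) + \<beta> / 2 * (Lsq + 2 * \<gamma>\<^sup>2 + 1)) * (norm v)\<^sup>2
      + (- (1 / (2 * Lsq)) * (\<gamma> / lam) + \<beta> / 2 * (Lsq + \<gamma>\<^sup>2 + 1)) * (norm w)\<^sup>2
      + (\<beta> / 2 + b / (2 * lam * Lsq))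
        * ((norm J)\<^sup>2 + (norm w)\<^sup>2 - Lsq * ((norm v)\<^sup>2 + (norm w)\<^sup>2))"
proof -
  define JJ where "JJ = J \<bullet> J"
  define Jv where "Jv = J \<bullet> v"
  define Jw where "Jw = J \<bullet> w"
  define vv where "vv = v \<bullet> v"
  define ww where "ww = w \<bullet> w"
  define wv where "wv = w \<bullet> v"
  have n: "(norm J)\<^sup>2 = JJ" "(norm v)\<^sup>2 = vv" "(norm w)\<^sup>2 = ww"
    by (simp_all add: JJ_def vv_def ww_def power2_norm_eq_inner)
  have C: "- C = 1 + \<gamma>\<^sup>2 - a\<^sup>2 - 3 * \<beta> * \<gamma> * lam"
  proof -
    have a: "a = \<gamma> * (Lsq / (Lsq + 1))" using pos(4) by (simp add: a_def b_def field_simps)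
    have "(2 * Lsq + 1) / (Lsq + 1)\<^sup>2 = ((Lsq + 1)\<^sup>2 - Lsq\<^sup>2) / (Lsq + 1)\<^sup>2"
      by (simp add: power2_eq_square algebra_simps)
    also have "\<dots> = 1 - (Lsq / (Lsq + 1))\<^sup>2"
      using pos(4) by (simp add: diff_divide_distrib power_divide)
    finally have "C = - (1 - (Lsq / (Lsq + 1))\<^sup>2) * \<gamma>\<^sup>2 + 3 * \<beta> * \<gamma> * lam - 1"
      by (simp add: C_def)
    moreover define r where "r = (Lsq / (Lsq + 1))\<^sup>2"
    ultimately show ?thesis unfolding a power_mult_distrib r_def[symmetric]
      by (simp add: algebra_simps)
  qed
  have young: "- Jv \<le> (Lsq * vv + JJ / Lsq) / 2"
  proof -
    have "0 \<le> (norm (Lsq *\<^sub>R v + J))\<^sup>2" by simp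
    also have "\<dots> = Lsq\<^sup>2 * vv + 2 * Lsq * Jv + JJ"
      unfolding power2_norm_eq_inner Jv_def JJ_def vv_def
      by (simp add: inner_simps inner_commute power2_eq_square algebra_simps)
    finally show ?thesis using pos(4) by (simp add: field_simps power2_eq_square)
  qed
  have GJ: "G \<bullet> (J + \<gamma> *\<^sub>R w + v)
      \<le> \<beta> / 2 * (JJ + (\<gamma>\<^sup>2 + 2) * ww + (2 * \<gamma>\<^sup>2 + 1) * vv + 6 * \<gamma> * wv)"
  proof -
    let ?q = "norm (w + \<gamma> *\<^sub>R v)"
    have prod: "G \<bullet> y \<le> \<beta> / 2 * (?q\<^sup>2 + (norm y)\<^sup>2)" for y
    proof -
      have "G \<bullet> y \<le> norm G * norm y" by (rule norm_cauchy_schwarz)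
      also have "\<dots> \<le> (\<beta> * ?q) * norm y" using G by (rule mult_right_mono) simp
      also have "\<dots> = \<beta> * (?q * norm y)" by simp
      also have "\<dots> \<le> \<beta> * ((?q\<^sup>2 + (norm y)\<^sup>2) / 2)"
        using pos(3) sum_squares_bound[of ?q "norm y"] by (intro mult_left_mono) auto
      finally show ?thesis by simp
    qed
    have q: "?q\<^sup>2 = ww + 2 * \<gamma> * wv + \<gamma>\<^sup>2 * vv"
      unfolding power2_norm_eq_inner ww_def wv_def vv_def
      by (simp add: inner_simps inner_commute power2_eq_square algebra_simps)
    have r: "(norm (\<gamma> *\<^sub>R w + v))\<^sup>2 = \<gamma>\<^sup>2 * ww + 2 * \<gamma> * wv + vv"
      unfolding power2_norm_eq_inner ww_def wv_def vv_def
      by (simp add: inner_simps inner_commute power2_eq_square algebra_simps)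
    have "G \<bullet> (J + \<gamma> *\<^sub>R w + v) = G \<bullet> J + G \<bullet> (\<gamma> *\<^sub>R w + v)" by (simp add: inner_simps)
    also have "\<dots> \<le> \<beta> / 2 * (?q\<^sup>2 + JJ) + \<beta> / 2 * (?q\<^sup>2 + (norm (\<gamma> *\<^sub>R w + v))\<^sup>2)"
      using prod[of J] prod[of "\<gamma> *\<^sub>R w + v"] by (simp add: n)
    also have "\<dots> = \<beta> / 2 * (JJ + (\<gamma>\<^sup>2 + 2) * ww + (2 * \<gamma>\<^sup>2 + 1) * vv + 6 * \<gamma> * wv)"
      unfolding q r by (simp add: algebra_simps)
    finally show ?thesis .
  qed
  have "(G - (w + \<gamma> *\<^sub>R v) /\<^sub>R lam) \<bullet> (J + \<gamma> *\<^sub>R w + v)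
      + (1 / lam) * ((J + a *\<^sub>R w) \<bullet> (w + a *\<^sub>R v)) - C / lam * (w \<bullet> v)
    = G \<bullet> (J + \<gamma> *\<^sub>R w + v)
      + (1 / lam) * ((J + a *\<^sub>R w) \<bullet> (w + a *\<^sub>R v) - (w + \<gamma> *\<^sub>R v) \<bullet> (J + \<gamma> *\<^sub>R w + v) - C * wv)"
    by (simp add: inner_diff_left divide_inverse wv_def algebra_simps)
  also have "(J + a *\<^sub>R w) \<bullet> (w + a *\<^sub>R v) - (w + \<gamma> *\<^sub>R v) \<bullet> (J + \<gamma> *\<^sub>R w + v) - C * wv
    = - (b * ww) - \<gamma> * vv + b * (- Jv) + (a\<^sup>2 - \<gamma>\<^sup>2 - 1 - C) * wv"
    unfolding a_def Jv_def vv_def ww_def wv_def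
    by (simp add: inner_simps inner_commute power2_eq_square algebra_simps)
  also have "a\<^sup>2 - \<gamma>\<^sup>2 - 1 - C = - (3 * \<beta> * \<gamma> * lam)" using C by simp
  also have "G \<bullet> (J + \<gamma> *\<^sub>R w + v)
      + (1 / lam) * (- (b * ww) - \<gamma> * vv + b * (- Jv) + - (3 * \<beta> * \<gamma> * lam) * wv)
    \<le> \<beta> / 2 * (JJ + (\<gamma>\<^sup>2 + 2) * ww + (2 * \<gamma>\<^sup>2 + 1) * vv + 6 * \<gamma> * wv)
      + (1 / lam) * (- (b * ww) - \<gamma> * vv + b * ((Lsq * vv + JJ / Lsq) / 2)
        + - (3 * \<beta> * \<gamma> * lam) * wv)"
    using pos young GJ
    by (intro add_mono order_refl mult_left_mono) (auto simp: b_def)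
  also have "\<dots> = (- (1 / 2) * (\<gamma> / lam) + \<beta> / 2 * (Lsq + 2 * \<gamma>\<^sup>2 + 1)) * vv
      + (- (1 / (2 * Lsq)) * (\<gamma> / lam) + \<beta> / 2 * (Lsq + \<gamma>\<^sup>2 + 1)) * ww
      + (\<beta> / 2 + b / (2 * lam * Lsq)) * (JJ + ww - Lsq * (vv + ww))"
  proof -
    define i where "i = 1 / lam"
    define j where "j = 1 / Lsq"
    have i: "lam * i = 1" and j: "j * Lsq = 1" using pos by (simp_all add: i_def j_def)
    have eqs: "\<gamma> / lam = \<gamma> * i" "1 / lam = i" "1 / (2 * Lsq) = j / 2" "JJ / Lsq = JJ * j"
      "b / (2 * lam * Lsq) = b * i * j / 2" by (simp_all add: i_def j_def)
    have bL: "b * Lsq = \<gamma> - b" using pos by (simp add: b_def field_simps)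
    have vv: "i * (- \<gamma> + b * Lsq / 2) = - (1 / 2) * (\<gamma> * i) - b * i * j / 2 * Lsq"
    proof -
      have "b * i * j / 2 * Lsq = b * i / 2 * (j * Lsq)" by simp
      then show ?thesis unfolding j bL by (simp add: field_simps)
    qed
    have ww: "i * (- b) = - (j / 2) * (\<gamma> * i) + b * i * j / 2 - b * i * j / 2 * Lsq"
    proof -
      have "\<gamma> = b + b * Lsq" using bL by simp
      then have "- (j / 2) * (\<gamma> * i) + b * i * j / 2 - b * i * j / 2 * Lsq = - (b * i * (j * Lsq))"
        by (simp add: algebra_simps)
      then show ?thesis unfolding j by simp
    qed
    have "\<beta> / 2 * (JJ + (\<gamma>\<^sup>2 + 2) * ww + (2 * \<gamma>\<^sup>2 + 1) * vv + 6 * \<gamma> * wv)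
        + i * (- (b * ww) - \<gamma> * vv + b * ((Lsq * vv + JJ * j) / 2) + - (3 * \<beta> * \<gamma> * lam) * wv)
      = \<beta> / 2 * (JJ + (\<gamma>\<^sup>2 + 2) * ww + (2 * \<gamma>\<^sup>2 + 1) * vv)
        + (i * (- b)) * ww + (i * (- \<gamma> + b * Lsq / 2)) * vv + b * i * j / 2 * JJ
        + 3 * \<beta> * \<gamma> * (1 - lam * i) * wv"
      by (simp add: algebra_simps)
    also have "\<dots> = (- (1 / 2) * (\<gamma> * i) + \<beta> / 2 * (Lsq + 2 * \<gamma>\<^sup>2 + 1)) * vv
      + (- (j / 2) * (\<gamma> * i) + \<beta> / 2 * (Lsq + \<gamma>\<^sup>2 + 1)) * ww
      + (\<beta> / 2 + b * i * j / 2) * (JJ + ww - Lsq * (vv + ww))"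
      unfolding i vv ww by (simp add: field_simps)
    finally show ?thesis unfolding eqs .
  qed
  finally show ?thesis unfolding n .
qed


lemma const_L_squared:
  "(const_L \<gamma> lam \<beta>)\<^sup>2
    = min (max ((\<gamma> + 1)\<^sup>2) ((\<gamma> + 2) * ((1 + lam * \<beta>)\<^sup>2 + 1)))
          (max ((\<gamma> + 1)\<^sup>2 + \<gamma> * lam * \<beta>) ((2 + lam * \<beta>)\<^sup>2 + \<gamma> * (2 + lam * \<beta>)))"
  (is "_ = min ?u1 ?u2") if "0 < \<gamma>" "0 < lam" "0 \<le> \<beta>"
proof -
  have "0 \<le> ?u1" by (rule max.coboundedI1) simp
  moreover have "0 \<le> ?u2" using that by (intro max.coboundedI1) simp
  ultimately show ?thesis by (auto simp: const_L_def const_L1_def const_L2_def min_def)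
qed

lemma const_L_squared_pos: "0 < (const_L \<gamma> lam \<beta>)\<^sup>2" if "0 < \<gamma>" "0 < lam" "0 \<le> \<beta>"
proof -
  have "0 < (\<gamma> + 1)\<^sup>2" using that by simp
  moreover have "0 \<le> \<gamma> * lam * \<beta>" using that by simp
  ultimately have "0 < (\<gamma> + 1)\<^sup>2 + \<gamma> * lam * \<beta>" by (rule add_pos_nonneg)
  with \<open>0 < (\<gamma> + 1)\<^sup>2\<close> show ?thesis
    unfolding const_L_squared[OF that] min_less_iff_conj less_max_iff_disj by blast
qed

text \<open>The constant \<open>L\<close> is a Lipschitz constant of the vector field of the system written as a first-order
  system in \<open>(x, x')\<close>. With \<open>p\<close>, \<open>q\<close>, \<open>d\<close> the increments of \<open>x\<close>, of \<open>x'\<close> and of the proximal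
  point, \<open>d - \<gamma> *\<^sub>R q - p\<close> is the increment of \<open>x''\<close>. The weighted Cauchy-Schwarz inequality with
  weights \<open>1, \<gamma>, 1\<close> gives \<^const>\<open>const_L1\<close>; the triangle inequality for \<open>d - p\<close> followed by
  Young's inequality gives \<^const>\<open>const_L2\<close>.\<close>

lemma const_L_lipschitz:
  fixes p q d :: "'a::real_normed_vector"
  assumes pos: "0 < \<gamma>" "0 < lam" "0 \<le> \<beta>" and d: "norm d \<le> (1 + lam * \<beta>) * norm p"
  shows "(norm q)\<^sup>2 + (norm (d - \<gamma> *\<^sub>R q - p))\<^sup>2
    \<le> (const_L \<gamma> lam \<beta>)\<^sup>2 * ((norm p)\<^sup>2 + (norm q)\<^sup>2)"
proof -
  define P Q where "P = norm p" and "Q = norm q"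
  define \<kappa> where "\<kappa> = 1 + lam * \<beta>"
  let ?n = "norm (d - \<gamma> *\<^sub>R q - p)"
  have nn: "0 \<le> P" "0 \<le> Q" by (simp_all add: P_def Q_def)
  have \<kappa>: "1 \<le> \<kappa>" using pos by (simp add: \<kappa>_def)
  have d: "norm d \<le> \<kappa> * P" using d by (simp add: P_def \<kappa>_def)
  have tri: "?n \<le> norm d + \<gamma> * Q + P"
    using norm_triangle_ineq4[of "d - \<gamma> *\<^sub>R q" p] norm_triangle_ineq4[of d "\<gamma> *\<^sub>R q"] pos
    by (simp add: P_def Q_def)
  have le_max: "v * P\<^sup>2 + u * Q\<^sup>2 \<le> max u v * (P\<^sup>2 + Q\<^sup>2)" for u v :: real
    using mult_right_mono[of v "max u v" "P\<^sup>2"] mult_right_mono[of u "max u v" "Q\<^sup>2"]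
    by (simp add: distrib_left)
  have 1: "Q\<^sup>2 + ?n\<^sup>2 \<le> max ((\<gamma> + 1)\<^sup>2) ((\<gamma> + 2) * (\<kappa>\<^sup>2 + 1)) * (P\<^sup>2 + Q\<^sup>2)"
  proof -
    let ?D = "norm d"
    have "?n\<^sup>2 \<le> (?D + \<gamma> * Q + P)\<^sup>2" using tri by (rule power_mono) simp
    also have "\<dots> = (\<gamma> + 2) * (?D\<^sup>2 + \<gamma> * Q\<^sup>2 + P\<^sup>2)
        - (\<gamma> * (?D - Q)\<^sup>2 + (?D - P)\<^sup>2 + \<gamma> * (Q - P)\<^sup>2)"
      by (simp add: power2_eq_square algebra_simps)
    also have "\<dots> \<le> (\<gamma> + 2) * (?D\<^sup>2 + \<gamma> * Q\<^sup>2 + P\<^sup>2)"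
    proof -
      have "0 \<le> \<gamma> * (?D - Q)\<^sup>2 + (?D - P)\<^sup>2 + \<gamma> * (Q - P)\<^sup>2"
        using pos by (intro add_nonneg_nonneg mult_nonneg_nonneg) auto
      then show ?thesis by linarith
    qed
    also have "\<dots> \<le> (\<gamma> + 2) * ((\<kappa> * P)\<^sup>2 + \<gamma> * Q\<^sup>2 + P\<^sup>2)"
      using d pos by (intro mult_left_mono add_mono power_mono order_refl) auto
    finally have "Q\<^sup>2 + ?n\<^sup>2 \<le> (\<gamma> + 2) * (\<kappa>\<^sup>2 + 1) * P\<^sup>2 + (\<gamma> + 1)\<^sup>2 * Q\<^sup>2"
      by (simp add: power2_eq_square algebra_simps)
    also note le_max
    finally show ?thesis .
  qed
  have 2: "Q\<^sup>2 + ?n\<^sup>2 \<le> max ((\<gamma> + 1)\<^sup>2 + \<gamma> * (\<kappa> - 1)) ((\<kappa> + 1)\<^sup>2 + \<gamma> * (\<kappa> + 1)) * (P\<^sup>2 + Q\<^sup>2)"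
  proof -
    let ?m = "\<kappa> + 1"
    have "?n \<le> ?m * P + \<gamma> * Q" using tri d by (simp add: algebra_simps)
    then have "?n\<^sup>2 \<le> (?m * P + \<gamma> * Q)\<^sup>2" by (rule power_mono) simp
    also have "\<dots> = ?m\<^sup>2 * P\<^sup>2 + \<gamma>\<^sup>2 * Q\<^sup>2 + \<gamma> * ?m * (2 * P * Q)"
      by (simp add: power2_eq_square algebra_simps)
    also have "\<dots> \<le> ?m\<^sup>2 * P\<^sup>2 + \<gamma>\<^sup>2 * Q\<^sup>2 + \<gamma> * ?m * (P\<^sup>2 + Q\<^sup>2)"
      using pos \<kappa> sum_squares_bound[of P Q] by (intro add_left_mono mult_left_mono) auto
    finally have "Q\<^sup>2 + ?n\<^sup>2
        \<le> ((\<kappa> + 1)\<^sup>2 + \<gamma> * (\<kappa> + 1)) * P\<^sup>2 + ((\<gamma> + 1)\<^sup>2 + \<gamma> * (\<kappa> - 1)) * Q\<^sup>2"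
      by (simp add: power2_eq_square algebra_simps)
    also note le_max
    finally show ?thesis .
  qed
  have s: "\<gamma> * lam * \<beta> = \<gamma> * (\<kappa> - 1)" "2 + lam * \<beta> = \<kappa> + 1" "1 + lam * \<beta> = \<kappa>"
    by (simp_all add: \<kappa>_def)
  show ?thesis
    unfolding const_L_squared[OF pos] s P_def[symmetric] Q_def[symmetric]
    using 1 2 by (simp add: min_def)
qed

section \<open>Curves of finite length\<close>

lemma norm_increment_le_integral:
  fixes X :: "real \<Rightarrow> 'a::euclidean_space" and N :: "real \<Rightarrow> real"
  assumes X: "\<And>t. 0 \<le> t \<Longrightarrow> (X has_vector_derivative X' t) (at t within {0..})"
    and N: "continuous_on {0..} N" "\<And>t. 0 \<le> t \<Longrightarrow> norm (X' t) \<le> N t"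
    and ab: "0 \<le> a" "a \<le> b"
  shows "norm (X b - X a) \<le> integral {a..b} N"
proof -
  have "(X' has_integral (X b - X a)) {a..b}"
    using ab by (intro fundamental_theorem_of_calculus)
      (auto intro!: has_vector_derivative_within_subset[OF X])
  moreover have "N integrable_on {a..b}"
    using N(1) ab by (intro integrable_continuous_interval) (auto elim: continuous_on_subset)
  ultimately show ?thesis
    using N(2) ab integral_norm_bound_integral[of X' "{a..b}" N]
    by (auto simp: has_integral_iff)
qed

text \<open>The capture argument of Lojasiewicz. As long as the curve stays in a ball around its cluster point
  \<open>xbar\<close>, its length is controlled by \<open>\<Psi>\<close>, which tends to \<open>0\<close>. Starting late enough and close enough
  to \<open>xbar\<close>, the curve is therefore too short to reach the boundary of the ball, so it never
  leaves. As the ball may be arbitrarily small, \<open>xbar\<close> is the limit; the bound on the length then holds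
  for all times.\<close>

lemma finite_length_trapping:
  fixes X :: "real \<Rightarrow> 'a::euclidean_space" and N \<Psi> :: "real \<Rightarrow> real"
  assumes X: "\<And>t. 0 \<le> t \<Longrightarrow> (X has_vector_derivative X' t) (at t within {0..})"
    and N: "continuous_on {0..} N" "\<And>t. 0 \<le> t \<Longrightarrow> norm (X' t) \<le> N t"
    and r: "0 < r" and c: "0 < c" and T: "0 \<le> T"
    and local_bound: "\<And>a b. T \<le> a \<Longrightarrow> a \<le> b \<Longrightarrow>
      (\<And>t. a \<le> t \<Longrightarrow> t < b \<Longrightarrow> dist (X t) xbar < r) \<Longrightarrow> c * integral {a..b} N \<le> \<Psi> a"
    and \<Psi>: "(\<Psi> \<longlongrightarrow> 0) at_top"
    and cluster: "\<And>e S. 0 < e \<Longrightarrow> \<exists>t\<ge>S. dist (X t) xbar < e"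
  shows "(X \<longlongrightarrow> xbar) at_top"
    and "\<exists>K S. 0 \<le> S \<and> (\<forall>b\<ge>S. integral {S..b} N \<le> K)"
proof -
  have trap: "\<exists>S\<ge>T. \<forall>b\<ge>S. dist (X b) xbar < 2 * e" if e: "0 < e" "2 * e \<le> r" for e
  proof -
    have "eventually (\<lambda>t. \<Psi> t < c * e) at_top"
      using \<Psi> c e by (intro order_tendstoD) auto
    then obtain T1 where T1: "\<And>t. T1 \<le> t \<Longrightarrow> \<Psi> t < c * e"
      by (auto simp: eventually_at_top_linorder)
    obtain S where S: "max T T1 \<le> S" "dist (X S) xbar < e" using cluster e by blast
    have "dist (X b) xbar < 2 * e" if b: "S \<le> b" for b
    proof (rule ccontr)
      assume out: "\<not> dist (X b) xbar < 2 * e"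
      have contX: "continuous_on {S..b} X"
        using S T by (intro continuous_on_vector_derivative[of _ _ X'])
          (auto intro!: has_vector_derivative_within_subset[OF X])
      \<comment> \<open>the minimum of \<open>Z\<close> is the first exit time from the ball of radius \<open>2 * e\<close>\<close>
      define Z where "Z = {S..b} \<inter> (\<lambda>t. dist (X t) xbar) -` {2 * e..}"
      have "closed Z"
        unfolding Z_def by (intro continuous_closed_preimage continuous_intros contX)
      moreover have "bounded Z" by (rule bounded_subset[of "{S..b}"]) (auto simp: Z_def)
      ultimately have "compact Z" by (simp add: compact_eq_bounded_closed)
      moreover have "b \<in> Z" using b out by (simp add: Z_def)
      ultimately obtain t where t: "t \<in> Z" "\<And>s. s \<in> Z \<Longrightarrow> t \<le> s"
        using compact_attains_inf[of Z] by auto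
      have St: "S \<le> t" "t \<le> b" using t(1) by (auto simp: Z_def)
      have inside: "dist (X s) xbar < 2 * e" if "S \<le> s" "s < t" for s
      proof (rule ccontr)
        assume "\<not> ?thesis"
        with that St have "s \<in> Z" by (simp add: Z_def)
        with t(2) that show False by force
      qed
      have "c * integral {S..t} N \<le> \<Psi> S"
        using S St inside e(2) by (intro local_bound) (auto intro: less_le_trans)
      also have "\<dots> < c * e" using T1 S by simp
      finally have "integral {S..t} N < e" using c by simp
      moreover have "norm (X t - X S) \<le> integral {S..t} N"
        using S T St by (intro norm_increment_le_integral[OF X N]) auto
      ultimately have "dist (X t) xbar < 2 * e"
        using S(2) dist_triangle[of "X t" xbar "X S"] by (simp add: dist_norm)
      with t(1) show False by (simp add: Z_def)
    qed
    with S(1) show ?thesis by (intro exI[of _ S]) auto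
  qed
  show "(X \<longlongrightarrow> xbar) at_top"
  proof (rule tendstoI)
    fix e :: real assume "0 < e"
    then obtain S where "\<forall>b\<ge>S. dist (X b) xbar < 2 * (min e r / 2)"
      using trap[of "min e r / 2"] r by auto
    then show "eventually (\<lambda>t. dist (X t) xbar < e) at_top"
      by (auto simp: eventually_at_top_linorder)
  qed
  obtain S where S: "T \<le> S" "\<forall>b\<ge>S. dist (X b) xbar < r" using trap[of "r / 2"] r by auto
  have "integral {S..b} N \<le> \<Psi> S / c" if "S \<le> b" for b
  proof -
    have "c * integral {S..b} N \<le> \<Psi> S" using S that by (intro local_bound) auto
    with c show ?thesis by (simp add: field_simps)
  qed
  with S(1) T show "\<exists>K S. 0 \<le> S \<and> (\<forall>b\<ge>S. integral {S..b} N \<le> K)"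
    by (intro exI[of _ "\<Psi> S / c"] exI[of _ S]) auto
qed

text \<open>Monotone convergence along the truncations of \<open>N\<close> to \<open>{0..k}\<close>.\<close>

lemma absolutely_integrable_on_halfline:
  fixes F :: "real \<Rightarrow> 'a::euclidean_space" and N :: "real \<Rightarrow> real"
  assumes F: "continuous_on {0..} F" and N: "continuous_on {0..} N"
    and FN: "\<And>t. 0 \<le> t \<Longrightarrow> norm (F t) \<le> N t"
    and S: "0 \<le> S" "\<And>b. S \<le> b \<Longrightarrow> integral {S..b} N \<le> K"
  shows "F absolutely_integrable_on {0..}"
proof -
  have N0: "0 \<le> N t" if "0 \<le> t" for t using FN[OF that] norm_ge_zero order_trans by blast
  have int: "N integrable_on {u..v}" if "0 \<le> u" for u v
    using N that by (intro integrable_continuous_interval) (auto elim: continuous_on_subset)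
  define h where "h k t = (if t \<in> {..real k} then N t else 0)" for k :: nat and t
  have inter: "{..real k} \<inter> {0..} = {0..real k}" for k by auto
  have hint: "h k integrable_on {0..}" for k
    unfolding h_def integrable_restrict_Int inter by (rule int) simp
  have hval: "integral {0..} (h k) = integral {0..real k} N" for k
    unfolding h_def integral_restrict_Int inter by (rule refl)
  have bound: "integral {0..real k} N \<le> integral {0..S} N + K" for k
  proof -
    let ?b = "max S (real k)"
    have "integral {0..real k} N \<le> integral {0..?b} N"
      using N0 by (intro integral_subset_le int) auto
    also have "\<dots> = integral {0..S} N + integral {S..?b} N"
      using Henstock_Kurzweil_Integration.integral_combine[where f = N and a = 0 and c = S and b = "?b"] S(1) int[of 0 ?b] by simp
    also have "\<dots> \<le> integral {0..S} N + K" using S(2) by simp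
    finally show ?thesis .
  qed
  have "N integrable_on {0..} \<and> (\<lambda>k. integral {0..} (h k)) \<longlonglongrightarrow> integral {0..} N"
  proof (rule monotone_convergence_increasing)
    show "h k integrable_on {0..}" for k by (rule hint)
    show "h k t \<le> h (Suc k) t" if "t \<in> {0..}" for k t using N0 that by (auto simp: h_def)
    show "(\<lambda>k. h k t) \<longlonglongrightarrow> N t" for t
    proof (rule tendsto_eventually)
      have "eventually (\<lambda>k. t \<le> real k) sequentially"
        using eventually_ge_at_top[of "nat \<lceil>t\<rceil>"] by eventually_elim (simp add: nat_ceiling_le_eq)
      then show "eventually (\<lambda>k. h k t = N t) sequentially"
        by eventually_elim (simp add: h_def)
    qed
    have "0 \<le> integral {0..real k} N" for k using N0 by (intro integral_nonneg int) auto
    with bound show "bounded (range (\<lambda>k. integral {0..} (h k)))"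
      unfolding hval by (intro boundedI[of _ "integral {0..S} N + K"]) auto
  qed
  then show ?thesis
    using F FN by (intro measurable_bounded_by_integrable_imp_absolutely_integrable[where g = N]
        continuous_imp_measurable_on_sets_lebesgue) auto
qed

lemma has_vector_derivative_right_quotient:
  assumes "(x has_vector_derivative v) (at t within {0..})" "0 \<le> t"
  shows "((\<lambda>s. (x s - x t) /\<^sub>R (s - t)) \<longlongrightarrow> v) (at_right t)"
proof -
  have "(x has_vector_derivative v) (at_right t)"
    using assms(2) by (intro has_vector_derivative_within_subset[OF assms(1)]) auto
  then have "((\<lambda>s. norm (x s - x t - (s - t) *\<^sub>R v) / norm (s - t)) \<longlongrightarrow> 0) (at_right t)"
    by (simp add: has_vector_derivative_def has_derivative_iff_norm)
  moreover have "eventually (\<lambda>s. norm (x s - x t - (s - t) *\<^sub>R v) / norm (s - t)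
      = norm ((x s - x t) /\<^sub>R (s - t) - v)) (at_right t)"
    using eventually_at_right_less[of t]
  proof eventually_elim
    case (elim s)
    have "(x s - x t) /\<^sub>R (s - t) - v = (x s - x t - (s - t) *\<^sub>R v) /\<^sub>R (s - t)"
      using elim by (simp add: scaleR_diff_right)
    then show ?case by (simp add: divide_inverse mult.commute)
  qed
  ultimately have "((\<lambda>s. norm ((x s - x t) /\<^sub>R (s - t) - v)) \<longlongrightarrow> 0) (at_right t)"
    by (simp cong: tendsto_cong)
  then show ?thesis by (simp add: LIM_zero_iff tendsto_norm_zero_iff)
qed


section \<open>The proximal-gradient map\<close>

text \<open>The right-hand side \<open>P\<close> of the system, the values \<open>fP\<close> of \<open>f\<close> along it and the subgradients
  \<open>\<xi>\<close> of \<open>f\<close> that come with the proximal map.\<close>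

locale prox_gradient_map =
  fixes f :: "'a::euclidean_space \<Rightarrow> ereal" and g :: "'a \<Rightarrow> real" and grad_g :: "'a \<Rightarrow> 'a"
    and \<beta> lam :: real
  assumes f: "proper_fun f" "convex_fun f" "lsc_fun f"
    and grad_g: "\<And>y. GDERIV g y :> grad_g y"
    and \<beta>: "0 \<le> \<beta>"
    and grad_g_lipschitz: "\<And>y z. norm (grad_g y - grad_g z) \<le> \<beta> * norm (y - z)"
    and lam: "0 < lam"
begin

definition P :: "'a \<Rightarrow> 'a" where "P y = prox lam f (y - lam *\<^sub>R grad_g y)"

definition fP :: "'a \<Rightarrow> real" where "fP y = real_of_ereal (f (P y))"

definition \<xi> :: "'a \<Rightarrow> 'a" where "\<xi> y = - ((P y - y) /\<^sub>R lam) - grad_g y"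

lemma f_P: "f (P y) = ereal (fP y)"
  unfolding P_def fP_def by (rule prox_subgradient(1)[OF f lam])

lemma \<xi>_subgradient: "ereal (fP y + \<xi> y \<bullet> (z - P y)) \<le> f z"
proof -
  have "\<xi> y = (y - lam *\<^sub>R grad_g y - P y) /\<^sub>R lam"
    using lam by (simp add: \<xi>_def scaleR_diff_right)
  then show ?thesis
    using prox_subgradient(2)[OF f lam, of "y - lam *\<^sub>R grad_g y" z] by (simp add: P_def fP_def)
qed

lemma fP_diff_le: "fP z - fP y \<le> \<xi> z \<bullet> (P z - P y)"
  using \<xi>_subgradient[of z "P y"] by (simp add: f_P inner_diff_right)

lemma P_lipschitz: "norm (P y - P z) \<le> (1 + lam * \<beta>) * norm (y - z)"
proof -
  have "norm (P y - P z) \<le> norm ((y - lam *\<^sub>R grad_g y) - (z - lam *\<^sub>R grad_g z))"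
    unfolding P_def by (rule prox_nonexpansive[OF f lam])
  also have "\<dots> = norm ((y - z) - lam *\<^sub>R (grad_g y - grad_g z))" by (simp add: algebra_simps)
  also have "\<dots> \<le> norm (y - z) + norm (lam *\<^sub>R (grad_g y - grad_g z))" by (rule norm_triangle_ineq4)
  also have "\<dots> \<le> norm (y - z) + lam * (\<beta> * norm (y - z))"
    using lam grad_g_lipschitz by simp
  finally show ?thesis by (simp add: algebra_simps)
qed

lemma continuous_P: "continuous_on S P"
proof (rule lipschitz_on_continuous_on)
  show "(1 + lam * \<beta>)-lipschitz_on S P"
    using P_lipschitz \<beta> lam by (intro lipschitz_onI) (auto simp: dist_norm)
qed

lemma continuous_grad_g: "continuous_on S grad_g"
proof (rule lipschitz_on_continuous_on)
  show "\<beta>-lipschitz_on S grad_g"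
    using grad_g_lipschitz \<beta> by (intro lipschitz_onI) (auto simp: dist_norm)
qed

lemma g_has_derivative: "(g has_derivative (\<lambda>d. d \<bullet> grad_g y)) (at y)"
  using grad_g by (simp add: gderiv_def)

lemma continuous_g: "continuous_on S g"
  by (intro continuous_at_imp_continuous_on ballI has_derivative_continuous[OF g_has_derivative])

lemma continuous_\<xi>: "continuous_on S \<xi>"
  unfolding \<xi>_def by (intro continuous_intros continuous_P continuous_grad_g)

text \<open>Although \<open>f\<close> itself is merely lower semicontinuous, it is continuous along proximal points: the
  subgradient inequalities at two such points bound the difference of the values from both sides.
  Hence \<open>f\<close> converges along the trajectory to its value at a cluster point.\<close>

lemma isCont_fP: "isCont fP y"
  unfolding isCont_def
proof (rule LIM_zero_cancel, rule Lim_null_comparison)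
  show "eventually (\<lambda>z. norm (fP z - fP y) \<le> (norm (\<xi> z) + norm (\<xi> y)) * norm (P z - P y)) (at y)"
  proof (rule always_eventually, rule allI)
    fix z
    have "fP z - fP y \<le> norm (\<xi> z) * norm (P z - P y)"
      using fP_diff_le[of z y] norm_cauchy_schwarz[of "\<xi> z" "P z - P y"] by linarith
    moreover have "fP y - fP z \<le> norm (\<xi> y) * norm (P z - P y)"
      using fP_diff_le[of y z] norm_cauchy_schwarz[of "\<xi> y" "P y - P z"]
      by (simp add: norm_minus_commute)
    moreover have "0 \<le> norm (\<xi> z) * norm (P z - P y)" "0 \<le> norm (\<xi> y) * norm (P z - P y)" by simp_all
    ultimately show "norm (fP z - fP y) \<le> (norm (\<xi> z) + norm (\<xi> y)) * norm (P z - P y)"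
      unfolding distrib_right real_norm_def by linarith
  qed
  have "(\<xi> \<longlongrightarrow> \<xi> y) (at y)" "(P \<longlongrightarrow> P y) (at y)"
    using continuous_\<xi>[of UNIV] continuous_P[of UNIV] by (simp_all add: continuous_on_def)
  then have "((\<lambda>z. (norm (\<xi> z) + norm (\<xi> y)) * norm (P z - P y))
      \<longlongrightarrow> (norm (\<xi> y) + norm (\<xi> y)) * norm (P y - P y)) (at y)"
    by (intro tendsto_intros)
  then show "((\<lambda>z. (norm (\<xi> z) + norm (\<xi> y)) * norm (P z - P y)) \<longlongrightarrow> 0) (at y)" by simp
qed

lemma continuous_fP: "continuous_on S fP"
  using isCont_fP by (simp add: continuous_at_imp_continuous_on)

lemma fixed_point_imp_crit:
  assumes "P y = y"
  shows "y \<in> crit (\<lambda>z. f z + ereal (g z))"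
proof -
  have "\<xi> y + grad_g y \<in> frechet_subdiff (\<lambda>z. f z + ereal (g z)) y"
  proof (rule frechet_subdiff_smooth_minorant[where k = "\<lambda>z. fP y + \<xi> y \<bullet> (z - y) + g z"])
    show "ereal (fP y + \<xi> y \<bullet> (z - y) + g z) \<le> f z + ereal (g z)" for z
      using add_right_mono[OF \<xi>_subgradient[of y z], of "ereal (g z)"] assms by simp
    show "f y + ereal (g y) = ereal (fP y + \<xi> y \<bullet> (y - y) + g y)"
      using f_P[of y] assms by simp
    show "((\<lambda>z. fP y + \<xi> y \<bullet> (z - y) + g z) has_derivative (\<lambda>d. (\<xi> y + grad_g y) \<bullet> d)) (at y)"
      by (auto intro!: derivative_eq_intros g_has_derivative
        simp: inner_add_left inner_add_right inner_commute)
  qed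
  moreover have "\<xi> y + grad_g y = 0" using assms by (simp add: \<xi>_def)
  ultimately show ?thesis
    using frechet_subdiff_subset_limiting unfolding crit_def by fastforce
qed

lemma H_fun_at_P:
  "H_fun f g \<gamma> lam \<beta> (P y, v, w)
    = ereal (fP y + g (P y) + 1 / (2 * lam) * (norm (P y - v))\<^sup>2
        - const_C \<gamma> lam \<beta> / (2 * lam) * (norm w)\<^sup>2)"
  by (simp add: H_fun_def f_P)

text \<open>The gradient at \<open>(P y, v, w)\<close> of the smooth minorant obtained from \<open>H\<close> by replacing \<open>f\<close> with its
  affine minorant of slope \<open>\<xi> y\<close>.\<close>

lemma H_fun_subgradient:
  "(\<xi> y + grad_g (P y) + (P y - v) /\<^sub>R lam, - ((P y - v) /\<^sub>R lam), - (const_C \<gamma> lam \<beta> / lam) *\<^sub>R w)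
    \<in> limiting_subdiff (H_fun f g \<gamma> lam \<beta>) (P y, v, w)"
proof -
  define C where "C = const_C \<gamma> lam \<beta>"
  define k where "k z = fP y + \<xi> y \<bullet> (fst z - P y) + g (fst z)
      + 1 / (2 * lam) * ((fst z - fst (snd z)) \<bullet> (fst z - fst (snd z)))
      - C / (2 * lam) * (snd (snd z) \<bullet> snd (snd z))" for z :: "'a \<times> 'a \<times> 'a"
  have "(\<xi> y + grad_g (P y) + (P y - v) /\<^sub>R lam, - ((P y - v) /\<^sub>R lam), - (C / lam) *\<^sub>R w)
    \<in> frechet_subdiff (H_fun f g \<gamma> lam \<beta>) (P y, v, w)"
  proof (rule frechet_subdiff_smooth_minorant[where k = k])
    show "ereal (k z) \<le> H_fun f g \<gamma> lam \<beta> z" for z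
    proof -
      obtain z1 z2 z3 where z: "z = (z1, z2, z3)" by (cases z)
      show ?thesis
        using \<xi>_subgradient[of y z1]
        by (cases "f z1") (auto simp: z k_def H_fun_def C_def power2_norm_eq_inner)
    qed
    show "H_fun f g \<gamma> lam \<beta> (P y, v, w) = ereal (k (P y, v, w))"
      by (simp add: H_fun_at_P k_def C_def power2_norm_eq_inner)
    have g': "((\<lambda>z. g (fst z)) has_derivative (\<lambda>d. fst d \<bullet> grad_g (P y))) (at (P y, v, w))"
      using has_derivative_compose[OF has_derivative_fst[OF has_derivative_ident], of g _ "(P y, v, w)" UNIV]
        g_has_derivative[of "P y"] by simp
    show "(k has_derivative
        (\<lambda>d. (\<xi> y + grad_g (P y) + (P y - v) /\<^sub>R lam, - ((P y - v) /\<^sub>R lam), - (C / lam) *\<^sub>R w) \<bullet> d))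
        (at (P y, v, w))"
      unfolding k_def
      by (rule derivative_eq_intros g' refl)+
        (use lam in \<open>auto simp: fun_eq_iff inner_add_left inner_add_right inner_diff_left inner_diff_right
          inner_commute field_simps\<close>)
  qed
  then show ?thesis using frechet_subdiff_subset_limiting unfolding C_def by blast
qed

end

section \<open>Decrease of the energy along a trajectory\<close>

locale prox_gradient_flow = prox_gradient_map f g grad_g \<beta> lam
  for f :: "'a::euclidean_space \<Rightarrow> ereal" and g grad_g \<beta> lam +
  fixes \<gamma> :: real and x x' x'' :: "real \<Rightarrow> 'a"
  assumes bounded_below: "\<exists>m::real. \<forall>y. ereal m \<le> f y + ereal (g y)"
    and \<gamma>: "0 < \<gamma>"
    and A_neg: "const_A \<gamma> lam \<beta> < 0" and B_neg: "const_B \<gamma> lam \<beta> < 0"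
    and C_neg: "const_C \<gamma> lam \<beta> < 0"
    and x': "\<And>t. 0 \<le> t \<Longrightarrow> (x has_vector_derivative x' t) (at t within {0..})"
    and x'': "\<And>t. 0 \<le> t \<Longrightarrow> (x' has_vector_derivative x'' t) (at t within {0..})"
    and C2: "continuous_on {0..} x''"
    and ode: "\<And>t. 0 \<le> t \<Longrightarrow> x'' t + \<gamma> *\<^sub>R x' t + x t = prox lam f (x t - lam *\<^sub>R grad_g (x t))"
begin

abbreviation Lsq where "Lsq \<equiv> (const_L \<gamma> lam \<beta>)\<^sup>2"
abbreviation A where "A \<equiv> const_A \<gamma> lam \<beta>"
abbreviation B where "B \<equiv> const_B \<gamma> lam \<beta>"
abbreviation C where "C \<equiv> const_C \<gamma> lam \<beta>"

text \<open>The energy \<open>E t\<close> is the value of \<open>H\<close> at the point \<open>z t\<close>. The shift by \<open>b *\<^sub>R x' t\<close> in the second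
  component turns \<open>u - v\<close> into \<open>x'' t + (\<gamma> - b) *\<^sub>R x' t\<close>, the combination for which the mixed terms
  cancel in the energy rate.\<close>

definition b where "b = \<gamma> / (Lsq + 1)"

definition E :: "real \<Rightarrow> real" where
  "E t = fP (x t) + g (P (x t)) + 1 / (2 * lam) * (norm (P (x t) - (x t + b *\<^sub>R x' t)))\<^sup>2
    - C / (2 * lam) * (norm (x' t))\<^sup>2"

definition z :: "real \<Rightarrow> 'a \<times> 'a \<times> 'a" where
  "z t = (P (x t), x t + b *\<^sub>R x' t, x' t)"

lemma H_z: "H_fun f g \<gamma> lam \<beta> (z t) = ereal (E t)"
  unfolding z_def E_def by (rule H_fun_at_P)

text \<open>The speed of \<open>(x, x')\<close>. Integrability of \<open>N\<close> is what has to be shown.\<close>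

definition N :: "real \<Rightarrow> real" where "N t = norm (x' t) + norm (x'' t)"

lemma N_nonneg: "0 \<le> N t" by (simp add: N_def)

lemma P_x: "0 \<le> t \<Longrightarrow> P (x t) = x'' t + \<gamma> *\<^sub>R x' t + x t"
  by (simp add: P_def ode)

lemma Lsq_pos: "0 < Lsq" by (rule const_L_squared_pos[OF \<gamma> lam \<beta>])

lemma b_pos: "0 < b"
  unfolding b_def using \<gamma> Lsq_pos by (intro divide_pos_pos) linarith+

lemma b_less: "b < \<gamma>"
proof -
  have "\<gamma> < \<gamma> * (Lsq + 1)" using mult_pos_pos[OF \<gamma> Lsq_pos] unfolding distrib_left by linarith
  moreover have "0 < Lsq + 1" using Lsq_pos by linarith
  ultimately show ?thesis unfolding b_def by (simp only: pos_divide_less_eq)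
qed

lemma P_minus_v: "0 \<le> t \<Longrightarrow> P (x t) - (x t + b *\<^sub>R x' t) = x'' t + (\<gamma> - b) *\<^sub>R x' t"
  by (simp add: P_x algebra_simps)

lemma continuous_x: "continuous_on {0..} x" and continuous_x': "continuous_on {0..} x'"
  using x' x'' by (auto intro: continuous_on_vector_derivative)

lemma continuous_N: "continuous_on {0..} N"
  unfolding N_def by (intro continuous_intros continuous_x' C2)

lemma continuous_E: "continuous_on {0..} E"
  unfolding E_def
  by (intro continuous_intros continuous_x continuous_x' continuous_on_compose2[OF continuous_P[of UNIV]]
      continuous_on_compose2[OF continuous_fP[of UNIV]] continuous_on_compose2[OF continuous_g[of UNIV]]) auto

text \<open>Formally this is the derivative of \<open>E\<close>, estimated by the lemma \<open>prox_grad_rate_bound\<close>. All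
  derivatives are replaced by difference quotients \<open>X\<close>, \<open>X1\<close>, \<open>J\<close>, \<open>D\<close> of \<open>x\<close>, \<open>x'\<close>, \<open>x''\<close> and \<open>P (x t)\<close>.
  The subgradient inequality at the later point bounds the increment of \<open>f\<close> from above without any
  chain rule. The quotient \<open>J\<close> need not converge; but it stays bounded through the Lipschitz
  constant \<open>L\<close>, and it enters the main part only through terms that the rate bound absorbs for an
  arbitrary \<open>J\<close>. Everything else converges, so the errors \<open>err1\<close> and \<open>err2\<close> tend to \<open>0\<close>.\<close>

lemma E_dini:
  assumes t: "0 \<le> t" and e: "0 < e"
  shows "eventually (\<lambda>s. E s - E t \<le> (A * (norm (x' t))\<^sup>2 + B * (norm (x'' t))\<^sup>2 + e) * (s - t)) (at_right t)"
proof -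
  define a where "a = \<gamma> - b"
  have a: "0 \<le> a" using b_less by (simp add: a_def)
  define \<kappa> where "\<kappa> = 1 + lam * \<beta>"
  have \<kappa>: "0 \<le> \<kappa>" using lam \<beta> by (simp add: \<kappa>_def)
  define v w where "v = x' t" and "w = x'' t"
  define y where "y s = x'' s + a *\<^sub>R x' s" for s
  define X where "X s = (x s - x t) /\<^sub>R (s - t)" for s
  define X1 where "X1 s = (x' s - x' t) /\<^sub>R (s - t)" for s
  define J where "J s = (x'' s - x'' t) /\<^sub>R (s - t)" for s
  define D where "D s = (P (x s) - P (x t)) /\<^sub>R (s - t)" for s
  define Q where "Q = \<xi> (x t) + grad_g (P (x t))"
  define main where "main j = Q \<bullet> (j + \<gamma> *\<^sub>R w + v) + (1 / lam) * ((j + a *\<^sub>R w) \<bullet> (w + a *\<^sub>R v))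
      - C / lam * (w \<bullet> v)" for j
  define S where "S = A * (norm v)\<^sup>2 + B * (norm w)\<^sup>2"
  define \<mu> where "\<mu> = \<beta> / 2 + b / (2 * lam * Lsq)"
  have \<mu>: "0 \<le> \<mu>" using \<beta> b_pos lam Lsq_pos by (simp add: \<mu>_def)

  have main_le: "main j \<le> S + \<mu> * ((norm j)\<^sup>2 + (norm w)\<^sup>2 - Lsq * ((norm v)\<^sup>2 + (norm w)\<^sup>2))" for j
  proof -
    define G where "G = grad_g (P (x t)) - grad_g (x t)"
    have px: "P (x t) - x t = w + \<gamma> *\<^sub>R v" using t by (simp add: P_x v_def w_def)
    have Q: "Q = G - (w + \<gamma> *\<^sub>R v) /\<^sub>R lam" by (simp add: Q_def \<xi>_def G_def px)
    have "norm G \<le> \<beta> * norm (w + \<gamma> *\<^sub>R v)"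
      unfolding G_def px[symmetric] by (rule grad_g_lipschitz)
    from prox_grad_rate_bound[OF \<gamma> lam \<beta> Lsq_pos this, of j]
    show ?thesis
      unfolding main_def Q a_def S_def \<mu>_def b_def const_A_def const_B_def const_C_def .
  qed

  define err1 where "err1 s = norm (\<xi> (x s) - \<xi> (x t)) * (\<kappa> * norm (X s))
      + Q \<bullet> (\<gamma> *\<^sub>R (X1 s - w) + (X s - v)) + \<beta> * (s - t) * (\<kappa> * norm (X s))\<^sup>2
      + 1 / (2 * lam) * ((\<kappa> * norm (X s) + norm (X s) + b * norm (X1 s)) * norm (y s - y t)
          + 2 * a * ((X1 s - w) \<bullet> y t))
      - C / (2 * lam) * (X1 s \<bullet> (x' s + x' t) - 2 * (w \<bullet> v))" for s
  define err2 where "err2 s = Lsq * ((norm (X s))\<^sup>2 + (norm (X1 s))\<^sup>2) - (norm (X1 s))\<^sup>2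
      + (norm w)\<^sup>2 - Lsq * ((norm v)\<^sup>2 + (norm w)\<^sup>2)" for s

  have cont: "(h \<longlongrightarrow> h t) (at_right t)" if "continuous_on {0..} h" for h :: "real \<Rightarrow> 'a"
  proof -
    have "(h \<longlongrightarrow> h t) (at t within {0..})" using that t by (simp add: continuous_on_def)
    then show ?thesis by (rule tendsto_within_subset) (use t in auto)
  qed
  have lim_X: "(X \<longlongrightarrow> v) (at_right t)" and lim_X1: "(X1 \<longlongrightarrow> w) (at_right t)"
    unfolding X_def X1_def v_def w_def
    using has_vector_derivative_right_quotient x' x'' t by blast+
  have lim_x': "(x' \<longlongrightarrow> v) (at_right t)"
    unfolding v_def by (rule cont[OF continuous_x'])
  have lim_y: "(y \<longlongrightarrow> y t) (at_right t)"
    unfolding y_def by (intro cont continuous_intros C2 continuous_x')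
  have lim_\<xi>: "((\<lambda>s. \<xi> (x s)) \<longlongrightarrow> \<xi> (x t)) (at_right t)"
    by (intro cont continuous_on_compose2[OF continuous_\<xi>[of UNIV] continuous_x]) auto
  have lim_t: "((\<lambda>s. s - t) \<longlongrightarrow> 0) (at_right t)"
    by (rule tendsto_eq_intros refl | simp)+
  have "(err1 \<longlongrightarrow> norm (\<xi> (x t) - \<xi> (x t)) * (\<kappa> * norm v)
      + Q \<bullet> (\<gamma> *\<^sub>R (w - w) + (v - v)) + \<beta> * 0 * (\<kappa> * norm v)\<^sup>2
      + 1 / (2 * lam) * ((\<kappa> * norm v + norm v + b * norm w) * norm (y t - y t)
          + 2 * a * ((w - w) \<bullet> y t))
      - C / (2 * lam) * (w \<bullet> (v + x' t) - 2 * (w \<bullet> v))) (at_right t)"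
    unfolding err1_def
    by (intro tendsto_intros lim_X lim_X1 lim_x' lim_y lim_\<xi> lim_t)
  then have lim1: "(err1 \<longlongrightarrow> 0) (at_right t)" by (simp add: v_def inner_add_right)
  have "(err2 \<longlongrightarrow> Lsq * ((norm v)\<^sup>2 + (norm w)\<^sup>2) - (norm w)\<^sup>2
      + (norm w)\<^sup>2 - Lsq * ((norm v)\<^sup>2 + (norm w)\<^sup>2)) (at_right t)"
    unfolding err2_def by (intro tendsto_intros lim_X lim_X1)
  then have lim2: "(err2 \<longlongrightarrow> 0) (at_right t)" by simp
  have "((\<lambda>s. err1 s + \<mu> * err2 s) \<longlongrightarrow> 0 + \<mu> * 0) (at_right t)"
    by (intro tendsto_intros lim1 lim2)
  then have small: "eventually (\<lambda>s. err1 s + \<mu> * err2 s < e) (at_right t)"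
    using e by (intro order_tendstoD) auto

  have bound: "E s - E t \<le> (S + (err1 s + \<mu> * err2 s)) * (s - t)" if s: "t < s" for s
  proof -
    have s0: "0 \<le> s" and h: "0 < s - t" using s t by auto
    have dx: "x s - x t = (s - t) *\<^sub>R X s" and dx': "x' s - x' t = (s - t) *\<^sub>R X1 s"
      and dx'': "x'' s - x'' t = (s - t) *\<^sub>R J s" and dP: "P (x s) - P (x t) = (s - t) *\<^sub>R D s"
      using h by (simp_all add: X_def X1_def J_def D_def)
    have D: "D s = J s + \<gamma> *\<^sub>R X1 s + X s"
      unfolding D_def J_def X1_def X_def P_x[OF s0] P_x[OF t]
      by (simp add: scaleR_diff_right scaleR_add_right algebra_simps)
    have dy: "y s - y t = (s - t) *\<^sub>R (J s + a *\<^sub>R X1 s)"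
    proof -
      have "y s - y t = (x'' s - x'' t) + a *\<^sub>R (x' s - x' t)" by (simp add: y_def algebra_simps)
      then show ?thesis unfolding dx' dx'' by (simp add: scaleR_add_right mult.commute)
    qed
    have Dle: "norm (D s) \<le> \<kappa> * norm (X s)"
    proof -
      have "norm (P (x s) - P (x t)) \<le> \<kappa> * norm (x s - x t)"
        unfolding \<kappa>_def by (rule P_lipschitz)
      then have "(s - t) * norm (D s) \<le> (s - t) * (\<kappa> * norm (X s))"
        unfolding dP dx using h by (simp add: mult.left_commute)
      with h show ?thesis by simp
    qed
    have fpart: "fP (x s) - fP (x t)
        \<le> (s - t) * (\<xi> (x t) \<bullet> D s + norm (\<xi> (x s) - \<xi> (x t)) * (\<kappa> * norm (X s)))"
    proof -
      have "(\<xi> (x s) - \<xi> (x t)) \<bullet> D s \<le> norm (\<xi> (x s) - \<xi> (x t)) * (\<kappa> * norm (X s))"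
        by (rule order_trans[OF norm_cauchy_schwarz mult_left_mono[OF Dle norm_ge_zero]])
      then have "\<xi> (x s) \<bullet> D s \<le> \<xi> (x t) \<bullet> D s + norm (\<xi> (x s) - \<xi> (x t)) * (\<kappa> * norm (X s))"
        by (simp add: inner_diff_left)
      then have "(s - t) * (\<xi> (x s) \<bullet> D s)
          \<le> (s - t) * (\<xi> (x t) \<bullet> D s + norm (\<xi> (x s) - \<xi> (x t)) * (\<kappa> * norm (X s)))"
        using h by (intro mult_left_mono) auto
      then show ?thesis using fP_diff_le[of "x s" "x t"] by (simp add: dP)
    qed
    have gpart: "g (P (x s)) - g (P (x t))
        \<le> (s - t) * (grad_g (P (x t)) \<bullet> D s + \<beta> * (s - t) * (\<kappa> * norm (X s))\<^sup>2)"
    proof -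
      have "g (P (x s)) - g (P (x t))
          \<le> grad_g (P (x t)) \<bullet> ((s - t) *\<^sub>R D s) + \<beta> * (norm ((s - t) *\<^sub>R D s))\<^sup>2"
        unfolding dP[symmetric] by (rule GDERIV_quadratic_bound[OF grad_g grad_g_lipschitz \<beta>])
      also have "\<dots> = (s - t) * (grad_g (P (x t)) \<bullet> D s + \<beta> * (s - t) * (norm (D s))\<^sup>2)"
      proof -
        have n: "norm ((s - t) *\<^sub>R D s) = (s - t) * norm (D s)" using h by simp
        show ?thesis
          unfolding n inner_scaleR_right power_mult_distrib power2_eq_square[of "s - t"]
          by (simp only: distrib_left mult.assoc mult.left_commute)
      qed
      also have "\<dots> \<le> (s - t) * (grad_g (P (x t)) \<bullet> D s + \<beta> * (s - t) * (\<kappa> * norm (X s))\<^sup>2)"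
        using h \<beta> Dle by (intro mult_left_mono add_left_mono power_mono) auto
      finally show ?thesis .
    qed
    have sq: "(norm p)\<^sup>2 - (norm q)\<^sup>2 = (p - q) \<bullet> (p + q)" for p q :: 'a
      unfolding power2_norm_eq_inner
      by (simp add: inner_diff_left inner_diff_right inner_add_right inner_commute)
    have ypart: "(norm (y s))\<^sup>2 - (norm (y t))\<^sup>2
        \<le> (s - t) * (2 * ((J s + a *\<^sub>R w) \<bullet> y t)
          + ((\<kappa> * norm (X s) + norm (X s) + b * norm (X1 s)) * norm (y s - y t)
          + 2 * a * ((X1 s - w) \<bullet> y t)))"
    proof -
      have "J s + a *\<^sub>R X1 s = D s - X s - b *\<^sub>R X1 s"
        unfolding D a_def by (simp add: algebra_simps)
      then have "norm (J s + a *\<^sub>R X1 s) \<le> \<kappa> * norm (X s) + norm (X s) + b * norm (X1 s)"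
        using Dle b_pos norm_triangle_ineq4[of "D s - X s" "b *\<^sub>R X1 s"] norm_triangle_ineq4[of "D s" "X s"]
        by simp
      then have "(J s + a *\<^sub>R X1 s) \<bullet> (y s - y t)
          \<le> (\<kappa> * norm (X s) + norm (X s) + b * norm (X1 s)) * norm (y s - y t)"
        by (rule order_trans[OF norm_cauchy_schwarz mult_right_mono]) simp
      moreover have "(J s + a *\<^sub>R X1 s) \<bullet> (y s + y t)
          = (J s + a *\<^sub>R X1 s) \<bullet> (y s - y t) + 2 * ((J s + a *\<^sub>R w) \<bullet> y t) + 2 * a * ((X1 s - w) \<bullet> y t)"
        by (simp add: inner_add_left inner_add_right inner_diff_left inner_diff_right algebra_simps)
      ultimately show ?thesis
        unfolding sq dy using h by simp
    qed
    have vpart: "(norm (x' s))\<^sup>2 - (norm (x' t))\<^sup>2 = (s - t) * (X1 s \<bullet> (x' s + x' t))"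
      unfolding sq dx' by simp
    have Eeq: "E u = fP (x u) + g (P (x u)) + 1 / (2 * lam) * (norm (y u))\<^sup>2 - C / (2 * lam) * (norm (x' u))\<^sup>2"
      if "0 \<le> u" for u
      unfolding E_def P_minus_v[OF that] y_def a_def ..
    have "E s - E t = (fP (x s) - fP (x t)) + (g (P (x s)) - g (P (x t)))
        + 1 / (2 * lam) * ((norm (y s))\<^sup>2 - (norm (y t))\<^sup>2)
        - C / (2 * lam) * ((norm (x' s))\<^sup>2 - (norm (x' t))\<^sup>2)"
      unfolding Eeq[OF s0] Eeq[OF t] by (simp add: right_diff_distrib)
    also have "\<dots> \<le> (s - t) * (\<xi> (x t) \<bullet> D s + norm (\<xi> (x s) - \<xi> (x t)) * (\<kappa> * norm (X s)))
        + (s - t) * (grad_g (P (x t)) \<bullet> D s + \<beta> * (s - t) * (\<kappa> * norm (X s))\<^sup>2)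
        + 1 / (2 * lam) * ((s - t) * (2 * ((J s + a *\<^sub>R w) \<bullet> y t)
          + ((\<kappa> * norm (X s) + norm (X s) + b * norm (X1 s)) * norm (y s - y t)
          + 2 * a * ((X1 s - w) \<bullet> y t))))
        - C / (2 * lam) * ((s - t) * (X1 s \<bullet> (x' s + x' t)))"
      unfolding vpart using lam
      by (intro diff_right_mono add_mono fpart gpart mult_left_mono ypart) auto
    also have "\<dots> = (s - t) * (main (J s) + err1 s)"
    proof -
      \<comment> \<open>the error terms were defined so that this is an identity\<close>
      have DQ: "Q \<bullet> D s = Q \<bullet> (J s + \<gamma> *\<^sub>R w + v) + Q \<bullet> (\<gamma> *\<^sub>R (X1 s - w) + (X s - v))"
        unfolding D by (simp add: inner_add_right inner_diff_right algebra_simps)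
      have yt: "y t = w + a *\<^sub>R v" by (simp add: y_def v_def w_def)
      have Q': "\<xi> (x t) \<bullet> D s + grad_g (P (x t)) \<bullet> D s = Q \<bullet> D s" by (simp add: Q_def inner_add_left)
      have half: "1 / (2 * lam) * (2 * r + q) = 1 / lam * r + 1 / (2 * lam) * q" for r q :: real
        using lam by (simp add: field_simps)
      have halfC: "C / (2 * lam) * r = C / (2 * lam) * (r - 2 * q) + C / lam * q" for r q :: real
        using lam by (simp add: field_simps)
      define Ja where "Ja = (J s + a *\<^sub>R w) \<bullet> (w + a *\<^sub>R v)"
      define r where "r = (\<kappa> * norm (X s) + norm (X s) + b * norm (X1 s)) * norm (y s - y t)
          + 2 * a * ((X1 s - w) \<bullet> y t)"
      have "(s - t) * (main (J s) + err1 s) = (s - t) * (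
          (\<xi> (x t) \<bullet> D s + grad_g (P (x t)) \<bullet> D s)
          + norm (\<xi> (x s) - \<xi> (x t)) * (\<kappa> * norm (X s)) + \<beta> * (s - t) * (\<kappa> * norm (X s))\<^sup>2
          + 1 / (2 * lam) * (2 * Ja + r) - C / (2 * lam) * (X1 s \<bullet> (x' s + x' t)))"
        unfolding main_def err1_def Q' DQ half
          halfC[of "X1 s \<bullet> (x' s + x' t)" "w \<bullet> v"] Ja_def[symmetric] r_def[symmetric]
        by (rule arg_cong[where f = "\<lambda>r. (s - t) * r"]) linarith
      also have "\<dots> = (s - t) * (\<xi> (x t) \<bullet> D s + norm (\<xi> (x s) - \<xi> (x t)) * (\<kappa> * norm (X s)))
        + (s - t) * (grad_g (P (x t)) \<bullet> D s + \<beta> * (s - t) * (\<kappa> * norm (X s))\<^sup>2)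
        + 1 / (2 * lam) * ((s - t) * (2 * Ja + r))
        - C / (2 * lam) * ((s - t) * (X1 s \<bullet> (x' s + x' t)))"
        by (simp only: distrib_left right_diff_distrib mult.left_commute mult.assoc add_ac)
      finally show ?thesis unfolding Ja_def r_def yt by simp
    qed
    also have "\<dots> \<le> (s - t) * (S + \<mu> * err2 s + err1 s)"
    proof -
      have "(norm (X1 s))\<^sup>2 + (norm (J s))\<^sup>2 \<le> Lsq * ((norm (X s))\<^sup>2 + (norm (X1 s))\<^sup>2)"
        using const_L_lipschitz[OF \<gamma> lam \<beta> Dle[unfolded \<kappa>_def], of "X1 s"] by (simp add: D)
      then have "\<mu> * ((norm (J s))\<^sup>2 + (norm w)\<^sup>2 - Lsq * ((norm v)\<^sup>2 + (norm w)\<^sup>2)) \<le> \<mu> * err2 s"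
        using \<mu> by (intro mult_left_mono) (auto simp: err2_def)
      with main_le[of "J s"] have "main (J s) + err1 s \<le> S + \<mu> * err2 s + err1 s" by linarith
      then show ?thesis using h by (intro mult_left_mono) auto
    qed
    finally show ?thesis by (simp add: mult.commute add_ac)
  qed
  from small eventually_at_right_less[of t] show ?thesis
  proof eventually_elim
    case (elim s)
    have "(S + (err1 s + \<mu> * err2 s)) * (s - t) \<le> (S + e) * (s - t)"
      using elim by (intro mult_right_mono) auto
    with bound[OF elim(2)] have "E s - E t \<le> (S + e) * (s - t)" by (rule order_trans)
    then show ?case by (simp add: S_def v_def w_def)
  qed
qed

end


context prox_gradient_flow
begin

text \<open>Half of the smaller decay coefficient, so that the rate can be expressed by \<open>(N t)\<^sup>2\<close>; the factor one
  half comes from \<open>(p + q)\<^sup>2 \<le> 2 * (p\<^sup>2 + q\<^sup>2)\<close>.\<close>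

definition \<delta> where "\<delta> = min (- A) (- B) / 2"

lemma \<delta>_pos: "0 < \<delta>" using A_neg B_neg by (simp add: \<delta>_def)

lemma rate_le: "A * (norm (x' t))\<^sup>2 + B * (norm (x'' t))\<^sup>2 \<le> - \<delta> * (N t)\<^sup>2"
proof -
  let ?p = "norm (x' t)" and ?q = "norm (x'' t)"
  have "A * ?p\<^sup>2 \<le> - (2 * \<delta>) * ?p\<^sup>2" "B * ?q\<^sup>2 \<le> - (2 * \<delta>) * ?q\<^sup>2"
    by (rule mult_right_mono; simp add: \<delta>_def)+
  then have "A * ?p\<^sup>2 + B * ?q\<^sup>2 \<le> - (2 * \<delta>) * (?p\<^sup>2 + ?q\<^sup>2)" by (simp add: distrib_left)
  also have "\<dots> \<le> - \<delta> * (N t)\<^sup>2"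
  proof -
    have "(N t)\<^sup>2 \<le> 2 * (?p\<^sup>2 + ?q\<^sup>2)"
      using sum_squares_bound[of ?p ?q] by (simp add: N_def power2_sum)
    from mult_left_mono[OF this, of \<delta>] \<delta>_pos show ?thesis by simp
  qed
  finally show ?thesis .
qed

lemma E_dini_N:
  assumes "0 \<le> t" "0 < e"
  shows "eventually (\<lambda>s. E s - E t \<le> (- \<delta> * (N t)\<^sup>2 + e) * (s - t)) (at_right t)"
  using E_dini[OF assms] eventually_at_right_less[of t]
proof eventually_elim
  case (elim s)
  have "(A * (norm (x' t))\<^sup>2 + B * (norm (x'' t))\<^sup>2 + e) * (s - t) \<le> (- \<delta> * (N t)\<^sup>2 + e) * (s - t)"
    using rate_le[of t] elim(2) by (intro mult_right_mono) auto
  with elim(1) show ?case by linarith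
qed

lemma continuous_interval:
  assumes "continuous_on {0..} (h :: real \<Rightarrow> real)" "0 \<le> s"
  shows "continuous_on {s..t} h"
  using assms by (auto elim: continuous_on_subset)

lemma E_decrease:
  assumes "0 \<le> s" "s \<le> t"
  shows "\<delta> * integral {s..t} (\<lambda>u. (N u)\<^sup>2) \<le> E s - E t"
proof -
  have "E t - E s \<le> integral {s..t} (\<lambda>u. - \<delta> * (N u)\<^sup>2)"
    using assms
    by (intro dini_imp_integral_bound continuous_interval continuous_E continuous_intros continuous_N E_dini_N) auto
  then show ?thesis by simp
qed

lemma E_antimono:
  assumes "0 \<le> s" "s \<le> t"
  shows "E t \<le> E s"
proof -
  have "0 \<le> integral {s..t} (\<lambda>u. (N u)\<^sup>2)"
    using assms by (intro integral_nonneg integrable_continuous_interval continuous_interval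
        continuous_intros continuous_N) auto
  then have "0 \<le> \<delta> * integral {s..t} (\<lambda>u. (N u)\<^sup>2)" using \<delta>_pos by simp
  with E_decrease[OF assms] show ?thesis by linarith
qed

lemma E_bounded_below: "\<exists>m. \<forall>t. m \<le> E t"
proof -
  obtain m :: real where m: "\<And>y. ereal m \<le> f y + ereal (g y)" using bounded_below by blast
  have "m \<le> E t" for t
  proof -
    have "m \<le> fP (x t) + g (P (x t))" using m[of "P (x t)"] by (simp add: f_P)
    moreover have "0 \<le> 1 / (2 * lam) * (norm (P (x t) - (x t + b *\<^sub>R x' t)))\<^sup>2" using lam by simp
    moreover have "C / (2 * lam) * (norm (x' t))\<^sup>2 \<le> 0"
      using C_neg lam by (intro mult_nonpos_nonneg divide_nonpos_pos) auto
    ultimately show ?thesis unfolding E_def by linarith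
  qed
  then show ?thesis by blast
qed

definition Einf where "Einf = Inf (E ` {0..})"

lemma Einf_le:
  assumes "0 \<le> t"
  shows "Einf \<le> E t"
proof -
  obtain m where "\<And>s. m \<le> E s" using E_bounded_below by blast
  then show ?thesis
    unfolding Einf_def using assms by (intro cInf_lower) (auto intro!: bdd_belowI2[of _ m])
qed

lemma E_tendsto: "(E \<longlongrightarrow> Einf) at_top"
proof (rule order_tendstoI)
  fix c assume "c < Einf"
  show "eventually (\<lambda>t. c < E t) at_top"
    using eventually_ge_at_top[of 0]
    by eventually_elim (use \<open>c < Einf\<close> Einf_le in \<open>blast intro: less_le_trans\<close>)
next
  fix c assume "Einf < c"
  then obtain s where s: "0 \<le> s" "E s < c"
    unfolding Einf_def using cInf_lessD[of "E ` {0..}" c] by auto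
  show "eventually (\<lambda>t. E t < c) at_top"
    using eventually_ge_at_top[of s]
    by eventually_elim (use s E_antimono in \<open>blast intro: le_less_trans\<close>)
qed

section \<open>Asymptotic behaviour\<close>

text \<open>The differential equation bounds the variation of \<open>x'\<close> and \<open>x''\<close> over an interval by the integral of
  \<open>N\<close>, so a value of \<open>N\<close> is controlled by the average over the following unit interval. This is the
  regularity needed to pass from square integrability of \<open>N\<close> to \<open>N\<close> tending to \<open>0\<close>.\<close>

lemma N_le_average:
  assumes t: "0 \<le> t"
  shows "N t \<le> (4 + lam * \<beta> + \<gamma>) * integral {t..t+1} N"
proof -
  define I where "I = integral {t..t+1} N"
  have int: "N integrable_on {u..v}" if "0 \<le> u" for u v
    by (intro integrable_continuous_interval continuous_interval continuous_N that)
  have le: "N t \<le> N s + (3 + lam * \<beta> + \<gamma>) * I" if s: "s \<in> {t..t+1}" for s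
  proof -
    have s0: "0 \<le> s" and ts: "t \<le> s" using s t by auto
    have part: "integral {t..s} N \<le> I"
      unfolding I_def using s t N_nonneg by (intro integral_subset_le int) auto
    have dx: "norm (x s - x t) \<le> I"
      using norm_increment_le_integral[OF x' continuous_N _ t ts] part by (simp add: N_def)
    have dx': "norm (x' s - x' t) \<le> I"
      using norm_increment_le_integral[OF x'' continuous_N _ t ts] part by (simp add: N_def)
    have "norm (P (x s) - P (x t)) \<le> (1 + lam * \<beta>) * I"
      using P_lipschitz[of "x s" "x t"] mult_left_mono[OF dx, of "1 + lam * \<beta>"] lam \<beta> by simp
    moreover have "norm (\<gamma> *\<^sub>R (x' s - x' t)) \<le> \<gamma> * I" using dx' \<gamma> by simp
    moreover have "x'' s - x'' t = (P (x s) - P (x t)) - \<gamma> *\<^sub>R (x' s - x' t) - (x s - x t)"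
      unfolding P_x[OF s0] P_x[OF t] by (simp add: algebra_simps)
    ultimately have dx'': "norm (x'' s - x'' t) \<le> (1 + lam * \<beta>) * I + \<gamma> * I + I"
      using dx norm_triangle_ineq4[of "(P (x s) - P (x t)) - \<gamma> *\<^sub>R (x' s - x' t)" "x s - x t"]
        norm_triangle_ineq4[of "P (x s) - P (x t)" "\<gamma> *\<^sub>R (x' s - x' t)"] by simp
    have "norm (x' t) \<le> norm (x' s) + I"
      using dx' norm_triangle_ineq2[of "x' t" "x' s"] by (simp add: norm_minus_commute)
    moreover have "norm (x'' t) \<le> norm (x'' s) + ((1 + lam * \<beta>) * I + \<gamma> * I + I)"
      using dx'' norm_triangle_ineq2[of "x'' t" "x'' s"] by (simp add: norm_minus_commute)
    ultimately show ?thesis unfolding N_def by (simp add: algebra_simps)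
  qed
  have "integral {t..t+1} (\<lambda>_. N t) \<le> integral {t..t+1} (\<lambda>s. N s + (3 + lam * \<beta> + \<gamma>) * I)"
    using le by (intro integral_le integrable_continuous_interval continuous_intros
        continuous_interval continuous_N t) auto
  also have "\<dots> = I + (3 + lam * \<beta> + \<gamma>) * I"
    using int[OF t] by (subst integral_add) (auto simp: I_def)
  finally show ?thesis by (simp add: I_def algebra_simps)
qed

text \<open>The energy converges, so its decrease over unit intervals vanishes, and with it the average of
  \<open>N\<^sup>2\<close>. The elementary inequality \<open>N \<le> N\<^sup>2 / (2 * \<epsilon>) + \<epsilon> / 2\<close> turns this into
  smallness of the average of \<open>N\<close>.\<close>

lemma N_tendsto_0: "(N \<longlongrightarrow> 0) at_top"
proof (rule tendstoI)
  fix e :: real assume e: "0 < e"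
  define M where "M = 4 + lam * \<beta> + \<gamma>"
  have M: "0 < M" using lam \<beta> \<gamma> by (simp add: M_def add_pos_nonneg)
  define \<epsilon> where "\<epsilon> = e / M"
  have \<epsilon>: "0 < \<epsilon>" using e M by (simp add: \<epsilon>_def)
  have "filterlim (\<lambda>t::real. t + 1) at_top at_top"
    by (rule filterlim_at_top_mono[OF filterlim_ident]) simp
  from tendsto_diff[OF E_tendsto filterlim_compose[OF E_tendsto this]]
  have "((\<lambda>t. E t - E (t + 1)) \<longlongrightarrow> Einf - Einf) at_top" .
  then have "eventually (\<lambda>t. E t - E (t + 1) < \<delta> * \<epsilon>\<^sup>2) at_top"
    using \<delta>_pos \<epsilon> by (intro order_tendstoD(2)) auto
  then show "eventually (\<lambda>t. dist (N t) 0 < e) at_top"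
    using eventually_ge_at_top[of 0]
  proof eventually_elim
    case (elim t)
    let ?J = "integral {t..t+1} (\<lambda>u. (N u)\<^sup>2)"
    have "\<delta> * ?J < \<delta> * \<epsilon>\<^sup>2" using E_decrease[of t "t + 1"] elim by simp
    then have J: "?J < \<epsilon>\<^sup>2" using \<delta>_pos by simp
    have "integral {t..t+1} N \<le> integral {t..t+1} (\<lambda>u. (1 / (2 * \<epsilon>)) * (N u)\<^sup>2 + \<epsilon> / 2)"
    proof (intro integral_le integrable_continuous_interval continuous_intros
        continuous_interval continuous_N elim)
      show "N u \<le> (1 / (2 * \<epsilon>)) * (N u)\<^sup>2 + \<epsilon> / 2" for u
        using sum_squares_bound[of "N u" \<epsilon>] \<epsilon> by (simp add: field_simps power2_eq_square)
    qed
    also have "\<dots> = (1 / (2 * \<epsilon>)) * ?J + \<epsilon> / 2"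
      using elim \<epsilon> by (subst integral_add)
        (auto intro!: integrable_continuous_interval continuous_intros continuous_interval continuous_N)
    also have "\<dots> < (1 / (2 * \<epsilon>)) * \<epsilon>\<^sup>2 + \<epsilon> / 2"
      using J \<epsilon> by (intro add_strict_right_mono mult_strict_left_mono) auto
    also have "\<dots> = \<epsilon>" using \<epsilon> by (simp add: power2_eq_square)
    finally have "M * integral {t..t+1} N < M * \<epsilon>" using M by (intro mult_strict_left_mono)
    then have "N t < e"
      using N_le_average[OF elim(2)] M by (simp add: M_def[symmetric] \<epsilon>_def)
    then show ?case using N_nonneg[of t] by simp
  qed
qed

lemma N_eq_0_if_E_eq_Einf:
  assumes t: "0 \<le> t" and E: "E t = Einf"
  shows "N t = 0"
proof -
  have "\<delta> * integral {t..t+1} (\<lambda>u. (N u)\<^sup>2) \<le> 0"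
    using E_decrease[of t "t + 1"] Einf_le[of "t + 1"] t E by simp
  then have "integral {t..t+1} (\<lambda>u. (N u)\<^sup>2) \<le> 0" using \<delta>_pos by (simp add: mult_le_0_iff)
  moreover have cont: "continuous_on {t..t+1} (\<lambda>u. (N u)\<^sup>2)"
    by (intro continuous_interval continuous_intros continuous_N t)
  moreover have "0 \<le> integral {t..t+1} (\<lambda>u. (N u)\<^sup>2)"
    using cont by (intro integral_nonneg integrable_continuous_interval) auto
  ultimately have "\<forall>u\<in>{t..t+1}. (N u)\<^sup>2 = 0"
    using integral_eq_0_iff[OF cont] by simp
  then show ?thesis by simp
qed

lemma displacement_tendsto_0:
  "((\<lambda>t. norm (P (x t) - x t)) \<longlongrightarrow> 0) at_top"
proof (rule Lim_null_comparison)
  show "eventually (\<lambda>t. norm (norm (P (x t) - x t)) \<le> (1 + \<gamma>) * N t) at_top"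
    using eventually_ge_at_top[of 0]
  proof eventually_elim
    case (elim t)
    have "norm (P (x t) - x t) \<le> norm (x'' t) + \<gamma> * norm (x' t)"
      using norm_triangle_ineq[of "x'' t" "\<gamma> *\<^sub>R x' t"] \<gamma> by (simp add: P_x[OF elim])
    also have "\<dots> \<le> (1 + \<gamma>) * N t" using \<gamma> by (simp add: N_def algebra_simps)
    finally show ?case by simp
  qed
  show "((\<lambda>t. (1 + \<gamma>) * N t) \<longlongrightarrow> 0) at_top"
    by (rule tendsto_eq_intros N_tendsto_0 refl | simp)+
qed

lemma z_near_diagonal:
  "((\<lambda>t. norm (z t - (x t, x t, 0))) \<longlongrightarrow> 0) at_top"
proof (rule Lim_null_comparison)
  show "eventually (\<lambda>t. norm (norm (z t - (x t, x t, 0))) \<le> norm (P (x t) - x t) + (b + 1) * N t) at_top"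
  proof (rule always_eventually, rule allI)
    fix t
    have "norm (z t - (x t, x t, 0)) \<le> norm (P (x t) - x t) + (norm (b *\<^sub>R x' t) + norm (x' t))"
      unfolding z_def by (auto intro!: order_trans[OF norm_Pair_le] add_left_mono norm_Pair_le)
    also have "norm (b *\<^sub>R x' t) + norm (x' t) = (b + 1) * norm (x' t)"
      using b_pos by (simp add: algebra_simps)
    also have "\<dots> \<le> (b + 1) * N t"
      using b_pos by (intro mult_left_mono) (auto simp: N_def)
    finally show "norm (norm (z t - (x t, x t, 0))) \<le> norm (P (x t) - x t) + (b + 1) * N t" by simp
  qed
  show "((\<lambda>t. norm (P (x t) - x t) + (b + 1) * N t) \<longlongrightarrow> 0) at_top"
    by (rule tendsto_eq_intros N_tendsto_0 displacement_tendsto_0 refl | simp)+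
qed

text \<open>Cluster points of \<open>x\<close> are fixed points of \<open>P\<close>, because \<open>P (x t) - x t = x'' t + \<gamma> *\<^sub>R x' t\<close> tends to
  \<open>0\<close>, and all of them carry the same energy, by continuity of \<open>fP\<close>.\<close>

lemma cluster_point:
  assumes r: "filterlim r at_top sequentially" and lim: "(\<lambda>n. x (r n)) \<longlonglongrightarrow> xbar"
  shows "P xbar = xbar" and "fP xbar + g xbar = Einf"
proof -
  have comp: "(\<lambda>n. h (x (r n))) \<longlonglongrightarrow> h xbar" if "continuous_on UNIV h" for h :: "'a \<Rightarrow> 'b::topological_space"
    using continuous_on_tendsto_compose[OF that lim] by simp
  have at: "((\<lambda>n. h (r n)) \<longlongrightarrow> l) sequentially" if "(h \<longlongrightarrow> l) at_top" for h :: "real \<Rightarrow> real" and l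
    using filterlim_compose[OF that r] .
  have "(\<lambda>n. norm (P (x (r n)) - x (r n))) \<longlonglongrightarrow> norm (P xbar - xbar)"
    by (intro tendsto_intros comp continuous_P lim)
  moreover have "(\<lambda>n. norm (P (x (r n)) - x (r n))) \<longlonglongrightarrow> 0"
    by (rule at[OF displacement_tendsto_0])
  ultimately have "norm (P xbar - xbar) = 0" by (rule LIMSEQ_unique)
  then show fix_P: "P xbar = xbar" by simp
  have N_r: "(\<lambda>n. N (r n)) \<longlonglongrightarrow> 0" by (rule at[OF N_tendsto_0])
  have x'_r: "(\<lambda>n. x' (r n)) \<longlonglongrightarrow> 0"
    by (rule Lim_null_comparison[OF _ N_r]) (simp add: N_def)
  have "(\<lambda>n. E (r n)) \<longlonglongrightarrow> fP xbar + g (P xbar)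
      + 1 / (2 * lam) * (norm (P xbar - (xbar + b *\<^sub>R 0)))\<^sup>2 - C / (2 * lam) * (norm (0::'a))\<^sup>2"
    unfolding E_def
    by (intro tendsto_intros comp[OF continuous_fP] comp[OF continuous_P] x'_r lim
        comp[OF continuous_on_compose2[OF continuous_g continuous_P]]) auto
  then have "(\<lambda>n. E (r n)) \<longlonglongrightarrow> fP xbar + g xbar" by (simp add: fix_P)
  then show "fP xbar + g xbar = Einf" using at[OF E_tendsto] by (rule LIMSEQ_unique)
qed

section \<open>Convergence under the Kurdyka-Lojasiewicz property\<close>

text \<open>A crude constant that bounds the norm of the subgradient at \<open>z t\<close> by a multiple of \<open>N t\<close>.\<close>

definition M where "M = (1 / lam + \<beta>) * (1 + \<gamma>) + 2 / lam * (1 + \<gamma>) + \<bar>C\<bar> / lam"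

lemma M_pos: "0 < M"
  using lam \<beta> \<gamma> by (simp add: M_def add_pos_nonneg)

lemma subgradient_distance:
  assumes t: "0 \<le> t"
  shows "edist_set 0 (limiting_subdiff (H_fun f g \<gamma> lam \<beta>) (z t)) \<le> ereal (M * N t)"
proof -
  define d e where "d = P (x t) - x t" and "e = P (x t) - (x t + b *\<^sub>R x' t)"
  define V where "V = (\<xi> (x t) + grad_g (P (x t)) + e /\<^sub>R lam, - (e /\<^sub>R lam), - (C / lam) *\<^sub>R x' t)"
  have "V \<in> limiting_subdiff (H_fun f g \<gamma> lam \<beta>) (z t)"
    unfolding V_def e_def z_def by (rule H_fun_subgradient)
  then have "edist_set 0 (limiting_subdiff (H_fun f g \<gamma> lam \<beta>) (z t)) \<le> ereal (norm V)"
    unfolding edist_set_def by (intro INF_lower2[of V]) simp_all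
  also have "norm V \<le> M * N t"
  proof -
    have d: "norm d \<le> (1 + \<gamma>) * N t"
    proof -
      have "norm d \<le> norm (x'' t) + \<gamma> * norm (x' t)"
        unfolding d_def using norm_triangle_ineq[of "x'' t" "\<gamma> *\<^sub>R x' t"] \<gamma> by (simp add: P_x[OF t])
      also have "\<dots> \<le> (1 + \<gamma>) * N t" using \<gamma> by (simp add: N_def algebra_simps)
      finally show ?thesis .
    qed
    have e: "norm e \<le> (1 + \<gamma>) * N t"
    proof -
      have "norm e \<le> norm (x'' t) + (\<gamma> - b) * norm (x' t)"
        unfolding e_def P_minus_v[OF t]
        using norm_triangle_ineq[of "x'' t" "(\<gamma> - b) *\<^sub>R x' t"] b_less by simp
      also have "\<dots> \<le> norm (x'' t) + \<gamma> * norm (x' t)"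
        using b_pos by (intro add_left_mono mult_right_mono) auto
      also have "\<dots> \<le> (1 + \<gamma>) * N t" using \<gamma> by (simp add: N_def algebra_simps)
      finally show ?thesis .
    qed
    define G where "G = grad_g (P (x t)) - grad_g (x t)"
    have eq: "\<xi> (x t) + grad_g (P (x t)) = G - d /\<^sub>R lam"
      by (simp add: \<xi>_def d_def G_def)
    have "norm G \<le> \<beta> * norm d" unfolding G_def d_def by (rule grad_g_lipschitz)
    moreover have "norm (d /\<^sub>R lam) = norm d / lam" using lam by (simp add: divide_inverse)
    ultimately have "norm (\<xi> (x t) + grad_g (P (x t))) \<le> \<beta> * norm d + norm d / lam"
      unfolding eq using norm_triangle_ineq4[of G "d /\<^sub>R lam"] by linarith
    also have "\<dots> = (1 / lam + \<beta>) * norm d" by (simp add: algebra_simps)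
    also have "\<dots> \<le> (1 / lam + \<beta>) * ((1 + \<gamma>) * N t)" using d lam \<beta> by (intro mult_left_mono) auto
    finally have 1: "norm (\<xi> (x t) + grad_g (P (x t))) \<le> (1 / lam + \<beta>) * ((1 + \<gamma>) * N t)" .
    have 2: "norm (e /\<^sub>R lam) \<le> 1 / lam * ((1 + \<gamma>) * N t)"
      using mult_left_mono[OF e, of "1 / lam"] lam by (simp add: divide_inverse)
    have 3: "norm ((- (C / lam)) *\<^sub>R x' t) \<le> \<bar>C\<bar> / lam * N t"
      using mult_left_mono[of "norm (x' t)" "N t" "\<bar>C\<bar> / lam"] lam by (simp add: N_def)
    have "norm V \<le> (norm (\<xi> (x t) + grad_g (P (x t))) + norm (e /\<^sub>R lam))
        + (norm (e /\<^sub>R lam) + norm ((- (C / lam)) *\<^sub>R x' t))"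
      unfolding V_def
      by (rule order_trans[OF norm_Pair_le add_mono[OF norm_triangle_ineq order_trans[OF norm_Pair_le]]]) simp
    also have "\<dots> \<le> M * N t"
    proof -
      have "M * N t = (1 / lam + \<beta>) * ((1 + \<gamma>) * N t) + 2 * (1 / lam * ((1 + \<gamma>) * N t))
          + \<bar>C\<bar> / lam * N t"
        by (simp add: M_def distrib_right mult.assoc)
      with 1 2 3 show ?thesis by linarith
    qed
    finally show ?thesis .
  qed
  finally show ?thesis by simp
qed

text \<open>The Lojasiewicz argument in one-sided derivatives. By concavity the graph of \<open>\<phi>\<close> lies below its tangents, so
  \<open>\<phi> (E t - Einf)\<close> decreases at least at the rate \<open>\<phi>' * \<delta> * (N t)\<^sup>2\<close>. The KL inequality together
  with the bound on the subgradient says \<open>1 \<le> \<phi>' * M * N t\<close>, so this rate is at least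
  \<open>\<delta> / M * N t\<close>: it is linear in the speed and hence integrates to a length.\<close>

lemma KL_length_bound:
  assumes \<eta>: "0 < \<eta>" and \<phi>: "\<phi> \<in> Theta \<eta>"
    and KL: "\<And>y. y \<in> U \<Longrightarrow> ereal Einf < H_fun f g \<gamma> lam \<beta> y \<Longrightarrow> H_fun f g \<gamma> lam \<beta> y < ereal Einf + \<eta> \<Longrightarrow>
      1 \<le> ereal (deriv \<phi> (real_of_ereal (H_fun f g \<gamma> lam \<beta> y - ereal Einf)))
        * edist_set 0 (limiting_subdiff (H_fun f g \<gamma> lam \<beta>) y)"
    and ab: "0 \<le> a'" "a' \<le> b'"
    and inside: "\<And>t. a' \<le> t \<Longrightarrow> t < b' \<Longrightarrow> z t \<in> U"
    and small: "ereal (E a' - Einf) < \<eta>"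
  shows "\<delta> / M * integral {a'..b'} N \<le> \<phi> (E a' - Einf)"
proof -
  let ?I = "{s. 0 \<le> s \<and> ereal s < \<eta>}" and ?Io = "{s. 0 < s \<and> ereal s < \<eta>}"
  define c where "c = \<delta> / M"
  define \<Psi> where "\<Psi> t = \<phi> (E t - Einf)" for t
  note \<Theta> = \<phi>[unfolded Theta_def mem_Collect_eq]
  have conc: "concave_on ?I \<phi>" and cont: "continuous_on ?I \<phi>" and C1: "\<phi> C1_differentiable_on ?Io"
    using \<Theta> by iprover+
  have nonneg: "0 \<le> \<phi> s" if "s \<in> ?I" for s using \<Theta> that by simp
  have dpos: "0 < deriv \<phi> s" if "s \<in> ?Io" for s using \<Theta> that by simp
  have inI: "E t - Einf \<in> ?I" if "a' \<le> t" for t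
  proof -
    have "ereal (E t - Einf) \<le> ereal (E a' - Einf)" using E_antimono[OF ab(1) that] by simp
    also note small
    finally show ?thesis using Einf_le[of t] ab(1) that by simp
  qed
  have openIo: "open ?Io"
  proof -
    have "open (ereal -` {..<\<eta>})" by (rule open_ereal_vimage) simp
    then have "open ({0<..} \<inter> ereal -` {..<\<eta>})" by (intro open_Int open_greaterThan)
    also have "{0<..} \<inter> ereal -` {..<\<eta>} = ?Io" by auto
    finally show ?thesis .
  qed
  have tangent: "\<phi> s' - \<phi> s \<le> deriv \<phi> s * (s' - s)" if s: "s \<in> ?Io" and s': "s' \<in> ?I" for s s'
  proof -
    have "\<phi> differentiable (at s)" using C1 s by (simp add: C1_differentiable_on_eq)
    then have "(\<phi> has_real_derivative deriv \<phi> s) (at s)"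
      by (simp add: DERIV_deriv_iff_real_differentiable)
    then have "((\<lambda>s. - \<phi> s) has_real_derivative - deriv \<phi> s) (at s within ?I)"
      by (rule DERIV_minus[OF has_field_derivative_at_within])
    moreover have "s \<in> interior ?I" using openIo s by (intro interiorI[of ?Io]) auto
    moreover have "convex_on ?I (\<lambda>s. - \<phi> s)" using conc by (simp add: concave_on_def)
    moreover have "connected ?I" using conc by (intro convex_connected concave_on_imp_convex)
    ultimately have "- deriv \<phi> s * (s' - s) \<le> - \<phi> s' - - \<phi> s"
      using s' convex_on_imp_above_tangent[of ?I "\<lambda>s. - \<phi> s" s s' "- deriv \<phi> s"] by blast
    then show ?thesis by simp
  qed
  have "\<Psi> b' - \<Psi> a' \<le> integral {a'..b'} (\<lambda>t. - c * N t)"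
  proof (rule dini_imp_integral_bound[OF ab(2)])
    show "continuous_on {a'..b'} \<Psi>"
      unfolding \<Psi>_def using ab inI
      by (intro continuous_on_compose2[OF cont] continuous_intros continuous_interval continuous_E) auto
    show "continuous_on {a'..b'} (\<lambda>t. - c * N t)"
      using ab by (intro continuous_interval continuous_intros continuous_N)
  next
    fix t e :: real assume t: "a' \<le> t" "t < b'" and e: "0 < e"
    have t0: "0 \<le> t" using ab t by simp
    show "eventually (\<lambda>u. \<Psi> u - \<Psi> t \<le> (- c * N t + e) * (u - t)) (at_right t)"
    \<comment> \<open>once the limit energy is attained the energy is constant, which forces the motion to have stopped\<close>
    proof (cases "E t = Einf")
      case True
      show ?thesis
        using eventually_at_right_less[of t]
      proof eventually_elim
        case (elim u)
        then have "E u = Einf" using E_antimono[of t u] Einf_le[of u] t0 True by simp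
        then have "\<Psi> u - \<Psi> t = 0" by (simp add: \<Psi>_def True)
        then show ?case using N_eq_0_if_E_eq_Einf[OF t0 True] e elim by simp
      qed
    next
      case False
      define s where "s = E t - Einf"
      have s: "s \<in> ?Io" using inI[OF t(1)] False by (simp add: s_def)
      define D where "D = deriv \<phi> s"
      have D: "0 < D" unfolding D_def using dpos s by blast
      have KL_t: "1 \<le> D * (M * N t)"
      proof -
        have "ereal (E t) < ereal Einf + \<eta>" using s by (cases \<eta>) (auto simp: s_def)
        then have "1 \<le> ereal D * edist_set 0 (limiting_subdiff (H_fun f g \<gamma> lam \<beta>) (z t))"
          using KL[OF inside[OF t]] s by (simp add: H_z s_def D_def)
        also have "\<dots> \<le> ereal D * ereal (M * N t)"
          using D subgradient_distance[OF t0] by (intro ereal_mult_left_mono) auto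
        finally show ?thesis by simp
      qed
      have rate: "D * (- \<delta> * (N t)\<^sup>2) \<le> - c * N t"
      proof -
        have "c * N t * 1 \<le> c * N t * (D * (M * N t))"
          using KL_t \<delta>_pos M_pos N_nonneg by (intro mult_left_mono) (auto simp: c_def)
        also have "\<dots> = D * (\<delta> * (N t)\<^sup>2)" using M_pos by (simp add: c_def power2_eq_square)
        finally show ?thesis by simp
      qed
      have "eventually (\<lambda>u. E u - E t \<le> (- \<delta> * (N t)\<^sup>2 + e / D) * (u - t)) (at_right t)"
        using e D by (intro E_dini_N t0) auto
      then show ?thesis
        using eventually_at_right_less[of t]
      proof eventually_elim
        case (elim u)
        have "\<Psi> u - \<Psi> t \<le> D * (E u - E t)"
          using tangent[OF s inI[of u]] elim t by (simp add: \<Psi>_def s_def D_def)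
        also have "\<dots> \<le> D * ((- \<delta> * (N t)\<^sup>2 + e / D) * (u - t))"
          using elim D by (intro mult_left_mono) auto
        also have "\<dots> = (D * (- \<delta> * (N t)\<^sup>2) + e) * (u - t)"
        proof -
          have "D * (r + e / D) = D * r + e" for r using D by (simp add: distrib_left)
          then show ?thesis by (simp only: mult.assoc[symmetric])
        qed
        also have "\<dots> \<le> (- c * N t + e) * (u - t)"
          using rate elim by (intro mult_right_mono) auto
        finally show ?case .
      qed
    qed
  qed
  moreover have "0 \<le> \<Psi> b'" unfolding \<Psi>_def using nonneg inI[OF ab(2)] by blast
  ultimately show ?thesis by (simp add: \<Psi>_def c_def)
qed

theorem trajectory_converges:
  assumes bounded: "bounded (x ` {0..})" and KL: "KL_function (H_fun f g \<gamma> lam \<beta>)"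
  shows "x' absolutely_integrable_on {0..}" and "x'' absolutely_integrable_on {0..}"
    and "\<exists>xbar \<in> crit (\<lambda>y. f y + ereal (g y)). (x \<longlongrightarrow> xbar) at_top"
proof -
  let ?H = "H_fun f g \<gamma> lam \<beta>"
  have "bounded (range (\<lambda>n. x (real n)))" by (rule bounded_subset[OF bounded]) auto
  then obtain xbar r where r: "strict_mono (r :: nat \<Rightarrow> nat)" "(\<lambda>n. x (real (r n))) \<longlonglongrightarrow> xbar"
    using bounded_imp_convergent_subsequence[of "\<lambda>n. x (real n)"] by (auto simp: o_def)
  have r_top: "filterlim (\<lambda>n. real (r n)) at_top sequentially"
    by (rule filterlim_compose[OF filterlim_real_sequentially filterlim_subseq[OF r(1)]])
  note limit = cluster_point[OF r_top r(2)]
  let ?z = "(xbar, xbar, 0) :: 'a \<times> 'a \<times> 'a"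
  have Hbar: "?H ?z = ereal Einf"
    using H_fun_at_P[of \<gamma> xbar xbar 0] limit by simp
  \<comment> \<open>\<open>H\<close> has to be subdifferentiable at the limit point before its KL property may be used there\<close>
  have "limiting_subdiff ?H ?z \<noteq> {}"
    using H_fun_subgradient[of xbar xbar \<gamma> 0] limit(1) by auto
  with KL have "KL_at ?H ?z" by (simp add: KL_function_def)
  then obtain \<eta> U \<phi> where \<eta>: "0 < \<eta>" and U: "open U" "?z \<in> U" and \<phi>: "\<phi> \<in> Theta \<eta>"
    and ineq: "\<And>y. y \<in> U \<Longrightarrow> ereal Einf < ?H y \<Longrightarrow> ?H y < ereal Einf + \<eta> \<Longrightarrow>
      1 \<le> ereal (deriv \<phi> (real_of_ereal (?H y - ereal Einf))) * edist_set 0 (limiting_subdiff ?H y)"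
    unfolding KL_at_def Hbar by blast
  obtain \<rho> where \<rho>: "0 < \<rho>" "ball ?z \<rho> \<subseteq> U" using U open_contains_ball by blast
  have "((\<lambda>t. ereal (E t - Einf)) \<longlongrightarrow> ereal (Einf - Einf)) at_top"
    by (intro tendsto_intros E_tendsto)
  then have small: "eventually (\<lambda>t. ereal (E t - Einf) < \<eta>) at_top"
    using \<eta> by (intro order_tendstoD(2)) (auto simp: zero_ereal_def)
  have near: "eventually (\<lambda>t. norm (z t - (x t, x t, 0)) < \<rho> / 2) at_top"
    using z_near_diagonal \<rho>(1) by (intro order_tendstoD(2)) auto
  obtain T where T: "0 \<le> T" "\<And>t. T \<le> t \<Longrightarrow> ereal (E t - Einf) < \<eta>"
    "\<And>t. T \<le> t \<Longrightarrow> norm (z t - (x t, x t, 0)) < \<rho> / 2"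
    using eventually_conj[OF eventually_ge_at_top[of 0] eventually_conj[OF small near]]
    unfolding eventually_at_top_linorder by (metis order_refl)
  have z_in: "z t \<in> U" if "T \<le> t" "dist (x t) xbar < \<rho> / 4" for t
  proof -
    have "norm ((x t, x t, 0) - ?z) \<le> norm (x t - xbar) + (norm (x t - xbar) + norm (0 :: 'a))"
      by (auto intro!: order_trans[OF norm_Pair_le] norm_Pair_le add_left_mono)
    also have "\<dots> < \<rho> / 2" using that(2) by (simp add: dist_norm)
    finally have "norm (z t - ?z) < \<rho>"
      using T(3)[OF that(1)] dist_triangle[of "z t" ?z "(x t, x t, 0)"]
      unfolding dist_norm by linarith
    then have "z t \<in> ball ?z \<rho>" by (simp add: dist_norm norm_minus_commute)
    with \<rho>(2) show ?thesis by blast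
  qed
  define \<Psi> where "\<Psi> = (\<lambda>t. \<phi> (E t - Einf))"
  have lim_\<Psi>: "(\<Psi> \<longlongrightarrow> 0) at_top"
  proof -
    have "((\<lambda>t. \<phi> (E t - Einf)) \<longlongrightarrow> \<phi> (Einf - Einf)) at_top"
    proof (rule continuous_on_tendsto_compose[where f = \<phi> and g = "\<lambda>t. E t - Einf" and s = "{s. 0 \<le> s \<and> ereal s < \<eta>}"])
      show "eventually (\<lambda>t. E t - Einf \<in> {s. 0 \<le> s \<and> ereal s < \<eta>}) at_top"
        using eventually_ge_at_top[of T]
        by eventually_elim (use T Einf_le in auto)
      show "continuous_on {s. 0 \<le> s \<and> ereal s < \<eta>} \<phi>" using \<phi> by (simp add: Theta_def)
      show "((\<lambda>t. E t - Einf) \<longlongrightarrow> Einf - Einf) at_top" by (intro tendsto_intros E_tendsto)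
      show "Einf - Einf \<in> {s. 0 \<le> s \<and> ereal s < \<eta>}" using \<eta> by (simp add: zero_ereal_def)
    qed
    then show ?thesis using \<phi> by (simp add: \<Psi>_def Theta_def)
  qed
  have local_bound: "\<delta> / M * integral {a..b} N \<le> \<Psi> a"
    if "T \<le> a" "a \<le> b" "\<And>t. a \<le> t \<Longrightarrow> t < b \<Longrightarrow> dist (x t) xbar < \<rho> / 4" for a b
    unfolding \<Psi>_def
  proof (rule KL_length_bound[OF \<eta> \<phi> ineq])
    show "0 \<le> a" "a \<le> b" "ereal (E a - Einf) < \<eta>" using that(1,2) T(1,2) by auto
    show "z t \<in> U" if "a \<le> t" "t < b" for t
      using \<open>T \<le> a\<close> that by (intro z_in \<open>\<And>t. a \<le> t \<Longrightarrow> t < b \<Longrightarrow> dist (x t) xbar < \<rho> / 4\<close>) auto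
  qed
  have cluster: "\<exists>t\<ge>S. dist (x t) xbar < e" if "0 < e" for e S
  proof -
    have "eventually (\<lambda>n. S \<le> real (r n) \<and> dist (x (real (r n))) xbar < e) sequentially"
      using r_top tendstoD[OF r(2) that] by (auto simp: filterlim_at_top eventually_conj_iff)
    then have "\<exists>n. S \<le> real (r n) \<and> dist (x (real (r n))) xbar < e"
      by (rule eventually_happens'[rotated]) simp
    then show ?thesis by blast
  qed
  have N_bounds: "norm (x' t) \<le> N t" "norm (x'' t) \<le> N t" for t by (simp_all add: N_def)
  have r4: "0 < \<rho> / 4" and c: "0 < \<delta> / M" using \<rho> \<delta>_pos M_pos by simp_all
  note trap = finite_length_trapping[OF x' continuous_N N_bounds(1) r4 c T(1) local_bound lim_\<Psi> cluster]
  show "\<exists>xbar \<in> crit (\<lambda>y. f y + ereal (g y)). (x \<longlongrightarrow> xbar) at_top"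
    using trap(1) fixed_point_imp_crit[OF limit(1)] by blast
  obtain K S where "0 \<le> S" "\<And>b. S \<le> b \<Longrightarrow> integral {S..b} N \<le> K" using trap(2) by blast
  then show "x' absolutely_integrable_on {0..}" "x'' absolutely_integrable_on {0..}"
    using absolutely_integrable_on_halfline continuous_x' C2 continuous_N N_bounds by blast+
qed

end

theorem theorem16:
  fixes f :: "real ^ 'n \<Rightarrow> ereal"
    and g :: "real ^ 'n \<Rightarrow> real"
    and grad_g :: "real ^ 'n \<Rightarrow> real ^ 'n"
    and \<beta> \<gamma> lam :: real
    and u0 v0 :: "real ^ 'n"
    and x x' x'' :: "real \<Rightarrow> real ^ 'n"
  assumes f: "proper_fun f" "convex_fun f" "lsc_fun f"
    and grad_g: "\<And>y. GDERIV g y :> grad_g y"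
    and \<beta>: "0 \<le> \<beta>"
    and grad_g_lipschitz: "\<And>y z. norm (grad_g y - grad_g z) \<le> \<beta> * norm (y - z)"
    and bounded_below: "\<exists>m::real. \<forall>y. ereal m \<le> f y + ereal (g y)"
    and pos: "0 < \<gamma>" "0 < lam"
    and ABC: "const_A \<gamma> lam \<beta> < 0" "const_B \<gamma> lam \<beta> < 0" "const_C \<gamma> lam \<beta> < 0"
    and x': "\<And>t. 0 \<le> t \<Longrightarrow> (x has_vector_derivative x' t) (at t within {0..})"
    and x'': "\<And>t. 0 \<le> t \<Longrightarrow> (x' has_vector_derivative x'' t) (at t within {0..})"
    and C2: "continuous_on {0..} x''"
    and ode: "\<And>t. 0 \<le> t \<Longrightarrow>
      x'' t + \<gamma> *\<^sub>R x' t + x t = prox lam f (x t - lam *\<^sub>R grad_g (x t))"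
    and init: "x 0 = u0" "x' 0 = v0"
    and x_bounded: "bounded (x ` {0..})"
    and KL: "KL_function (H_fun f g \<gamma> lam \<beta>)"
  shows "x' absolutely_integrable_on {0..}
    \<and> x'' absolutely_integrable_on {0..}
    \<and> (\<exists>xbar \<in> crit (\<lambda>y. f y + ereal (g y)). (x \<longlongrightarrow> xbar) at_top)"
proof -
  interpret prox_gradient_flow f g grad_g \<beta> lam \<gamma> x x' x''
    by unfold_locales (fact assms)+
  show ?thesis using trajectory_converges[OF x_bounded KL] by blast
qed

end
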